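(* Let $z_1,z_2\in\mathbb P$ with $z_2\neq z_1$, let $\mathtt v\in\mathbf W^{z_1}$, and set $$S(z_1)=e^3(z_1)+3e^2(z_1)i(z_1)+3e(z_1)i^2(z_1)+i^3(z_1):\mathbf W^{z_1}\to\mathbf W\otimes K_{z_1}^3 .$$ Then, as $z_2\to z_1$, $$\bigl[2\,b(z_2)T(z_1)-2\,\omega(z_2,z_1)\,b(z_1)\bigr]\mathtt v\ \longrightarrow\ S(z_1)\,\mathtt v ,$$ that is, an element of $\mathbf W\otimes K_{z_2}\otimes K_{z_1}^2$ tends to an element of $\mathbf W\otimes K_{z_1}^3$.
   Context: $\mathbb P$ is a complex projective line; $K$ its canonical bundle, $K_z$ the fibre at $z$. A coordinate is a meromorphic function $u$ on $\mathbb P$ with exactly one pole, which is simple; $du_z\in K_z$ is the value of $du$ at $z$ (for $z$ not the pole). $\mathbf K$ is the space of meromorphic 1-forms on $\mathbb P$ of the second kind (all residues zero), $\mathbf K^z\subset\mathbf K$ the subspace of forms regular at $z$; $\mathbf W=S^*\mathbf K$ and $\mathbf W^z=S^*\mathbf K^z$ are the (algebraic) symmetric algebras, with vacuum $\mathbf 1=1\in\mathbb C$. Fields: $e(z):\mathbf W\to\mathbf W\otimes K_z$ is multiplication by $e_z=-\frac{du}{(u-u(z))^2}\otimes du_z$ ($u$ any coordinate regular at $z$; $e_z$ is independent of $u$). $i(z):\mathbf W^z\to\mathbf W^z\otimes K_z$ is the derivation with $i(z)\mathbf 1=0$ and $i(z)\alpha=-\alpha(z)$ for $\alpha\in\mathbf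 K^z$. $b(z)=i(z)+e(z):\mathbf W^z\to\mathbf W\otimes K_z$. The energy-momentum tensor is $T(z)=\tfrac12\{i(z)\circ i(z)+e(z)\circ e(z)+2e(z)\circ i(z)\}:\mathbf W^z\to\mathbf W\otimes K_z^2$. In all products powers of $e$ are written to the left of powers of $i$. $\omega(z_2,z_1)=\frac{1}{(u(z_2)-u(z_1))^2}\,du_{z_2}\otimes^s du_{z_1}$, where tensor factors $K_{z_1},K_{z_2}$ are exchanged without signs; $\omega$ does not depend on the coordinate. Limits: for $\mathtt v\in\mathbf W^{z_1}$ the expressions are defined for $z_2\ne z_1$ in a Zariski neighbourhood of $z_1$ (depending on $\mathtt v$). After trivialising $K$ by $du$ near $z_1$, the degree $m$ component of the expression is a symmetric polydifferential in $m$ auxiliary points depending rationally on those points and on $u(z_2)$; the limit statement means that each component has no pole along $z_2=z_1$ and that its restriction to $z_2=z_1$ is the corresponding component of the right side. *)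

theory Defs
  imports
    "HOL-Complex_Analysis.Complex_Analysis"
    "HOL-Combinatorics.Permutations"
    "HOL-Library.Multiset"
    "HOL-Library.Poly_Mapping"
begin

section \<open>The projective line, meromorphic functions and coordinates\<close>

datatype pline = Aff complex | Infty

datatype chart_index = Std | AtInf

fun chart :: "chart_index \<Rightarrow> complex \<Rightarrow> pline" where
  "chart Std t = Aff t"
| "chart AtInf w = (if w = 0 then Infty else Aff (1 / w))"

text \<open>A meromorphic function is represented by a total function; the requirement
  \<open>nicely_meromorphic_on\<close> makes the representation unique (it is continuous away from the poles
  and takes the dummy value 0 at the poles).\<close>

definition meromorphic_fun :: "(pline \<Rightarrow> complex) \<Rightarrow> bool" where
  "meromorphic_fun u \<longleftrightarrow> (\<forall>k. (\<lambda>t. u (chart k t)) nicely_meromorphic_on UNIV)"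

definition has_pole_at :: "(pline \<Rightarrow> complex) \<Rightarrow> pline \<Rightarrow> bool" where
  "has_pole_at u p \<longleftrightarrow> (\<exists>k t. chart k t = p \<and> is_pole (\<lambda>s. u (chart k s)) t)"

definition simple_pole_at :: "(pline \<Rightarrow> complex) \<Rightarrow> pline \<Rightarrow> bool" where
  "simple_pole_at u p \<longleftrightarrow>
     (\<exists>k t. chart k t = p \<and> is_pole (\<lambda>s. u (chart k s)) t \<and> zorder (\<lambda>s. u (chart k s)) t = -1)"

definition coordinate :: "(pline \<Rightarrow> complex) \<Rightarrow> bool" where
  "coordinate u \<longleftrightarrow> meromorphic_fun u \<and> (\<exists>!p. has_pole_at u p) \<and>
     (\<forall>p. has_pole_at u p \<longrightarrow> simple_pole_at u p)"


section \<open>Meromorphic 1-forms of the second kind\<close>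

text \<open>A meromorphic 1-form is given by its coefficient functions \<open>\<phi> Std\<close> and \<open>\<phi> AtInf\<close> with
  respect to \<open>dt\<close> and \<open>dw\<close>, where \<open>w = 1/t\<close> and hence \<open>dw = - dt / t\<^sup>2\<close>. As for functions, the
  coefficients are normalised to be 0 at poles.\<close>

definition meromorphic_form :: "(chart_index \<Rightarrow> complex \<Rightarrow> complex) \<Rightarrow> bool" where
  "meromorphic_form \<phi> \<longleftrightarrow> (\<forall>k. \<phi> k nicely_meromorphic_on UNIV) \<and>
     (\<forall>t. t \<noteq> 0 \<longrightarrow> \<phi> Std t = - \<phi> AtInf (1 / t) / t ^ 2)"

definition second_kind :: "(chart_index \<Rightarrow> complex \<Rightarrow> complex) \<Rightarrow> bool" where
  "second_kind \<phi> \<longleftrightarrow> (\<forall>k t. residue (\<phi> k) t = 0)"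

typedef kform = "{\<phi>. meromorphic_form \<phi> \<and> second_kind \<phi>}"
  morphisms form_coeff Abs_kform
proof
  show "(\<lambda>_ _. 0) \<in> {\<phi>. meromorphic_form \<phi> \<and> second_kind \<phi>}"
    by (auto simp: meromorphic_form_def second_kind_def residue_const)
qed

text \<open>The form whose coefficients agree with \<open>\<phi>\<close> up to values on a discrete set.\<close>

definition mk_form :: "(chart_index \<Rightarrow> complex \<Rightarrow> complex) \<Rightarrow> kform" where
  "mk_form \<phi> = Abs_kform (\<lambda>k. remove_sings (\<phi> k))"

lemma filtermap_inverse_at:
  assumes "t \<noteq> (0::complex)"
  shows "filtermap (\<lambda>s. 1 / s) (at t) = at (1 / t)"
proof (rule filtermap_fun_inverse)
  show "filterlim (\<lambda>s. 1 / s) (at t) (at (1 / t))"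
    unfolding filterlim_at
  proof
    have "(\<lambda>s. 1 / s) \<midarrow>1 / t\<rightarrow> 1 / (1 / t)"
      by (intro tendsto_intros) (use assms in auto)
    then show "(\<lambda>s. 1 / s) \<midarrow>1 / t\<rightarrow> t" by simp
    have "\<forall>\<^sub>F x in at (1 / t). x \<noteq> 1 / t" by (simp add: eventually_at_filter)
    then show "\<forall>\<^sub>F x in at (1 / t). 1 / x \<in> UNIV \<and> 1 / x \<noteq> t"
      by eventually_elim auto
  qed
  show "filterlim (\<lambda>s. 1 / s) (at (1 / t)) (at t)"
    unfolding filterlim_at
  proof
    show "(\<lambda>s. 1 / s) \<midarrow>t\<rightarrow> 1 / t"
      by (intro tendsto_intros) (use assms in auto)
    have "\<forall>\<^sub>F x in at t. x \<noteq> t" by (simp add: eventually_at_filter)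
    then show "\<forall>\<^sub>F x in at t. 1 / x \<in> UNIV \<and> 1 / x \<noteq> 1 / t"
      by eventually_elim auto
  qed
  show "\<forall>\<^sub>F x in at (1 / t). 1 / (1 / x) = x" by simp
qed

lemma remove_sings_transition:
  assumes t: "t \<noteq> 0" and mero: "g meromorphic_on UNIV"
  shows "remove_sings (\<lambda>s. - g (1 / s) / s ^ 2) t = - remove_sings g (1 / t) / t ^ 2"
proof -
  let ?h = "\<lambda>s. g (1 / s)"
  have eq: "remove_sings ?h t = remove_sings g (1 / t)"
    using remove_sings_compose[OF filtermap_inverse_at[OF t], of g] by (simp add: o_def)
  show ?thesis
  proof (cases "\<exists>c. ?h \<midarrow>t\<rightarrow> c")
    case True
    then obtain c where c: "?h \<midarrow>t\<rightarrow> c" by auto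
    have "(\<lambda>s. - ?h s / s ^ 2) \<midarrow>t\<rightarrow> - c / t ^ 2"
      using t by (intro tendsto_intros c) auto
    then show ?thesis using c eq by (metis remove_sings_eqI)
  next
    case False
    have "\<not> (\<exists>c. (\<lambda>s. - ?h s / s ^ 2) \<midarrow>t\<rightarrow> c)"
    proof
      assume "\<exists>c. (\<lambda>s. - ?h s / s ^ 2) \<midarrow>t\<rightarrow> c"
      then obtain c where c: "(\<lambda>s. - ?h s / s ^ 2) \<midarrow>t\<rightarrow> c" by auto
      have "(\<lambda>s. - (- ?h s / s ^ 2) * s ^ 2) \<midarrow>t\<rightarrow> - c * t ^ 2"
        by (intro tendsto_intros c)
      moreover have "\<forall>\<^sub>F s in at t. s \<noteq> 0"
        using t by (simp add: eventually_neq_at_within)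
      then have "\<forall>\<^sub>F s in at t. - (- ?h s / s ^ 2) * s ^ 2 = ?h s"
        by eventually_elim auto
      ultimately have "?h \<midarrow>t\<rightarrow> - c * t ^ 2"
        by (simp add: tendsto_cong)
      with False show False by blast
    qed
    then show ?thesis using eq False by (auto simp: remove_sings_def)
  qed
qed

lemma coeff_mk_form:
  assumes mero: "\<And>k. \<phi> k meromorphic_on UNIV"
    and trans: "\<And>t. t \<noteq> 0 \<Longrightarrow> \<forall>\<^sub>F s in at t. \<phi> Std s = - \<phi> AtInf (1 / s) / s ^ 2"
    and res: "\<And>k t. residue (\<phi> k) t = 0"
  shows "form_coeff (mk_form \<phi>) k = remove_sings (\<phi> k)"
proof -
  have "(\<lambda>k. remove_sings (\<phi> k)) \<in> {\<phi>. meromorphic_form \<phi> \<and> second_kind \<phi>}"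
    unfolding meromorphic_form_def second_kind_def
  proof (safe)
    show "remove_sings (\<phi> k) nicely_meromorphic_on UNIV" for k
      using mero remove_sings_nicely_meromorphic by blast
    show "remove_sings (\<phi> Std) t = - remove_sings (\<phi> AtInf) (1 / t) / t ^ 2" if "t \<noteq> 0" for t
      using remove_sings_transition[OF that mero] remove_sings_cong[OF trans[OF that] refl]
      by simp
    show "residue (remove_sings (\<phi> k)) t = 0" for k t
      using res mero by (metis UNIV_I meromorphic_on_isolated_singularity residue_remove_sings
        meromorphic_on_subset subset_UNIV)
  qed
  then show ?thesis by (simp add: mk_form_def Abs_kform_inverse)
qed

lemma coeff_props:
  shows "form_coeff \<alpha> k nicely_meromorphic_on UNIV" "form_coeff \<alpha> k meromorphic_on UNIV"
    "t \<noteq> 0 \<Longrightarrow> form_coeff \<alpha> Std t = - form_coeff \<alpha> AtInf (1 / t) / t ^ 2"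
    "residue (form_coeff \<alpha> k) t = 0"
    "remove_sings (form_coeff \<alpha> k) = form_coeff \<alpha> k"
proof -
  have *: "meromorphic_form (form_coeff \<alpha>)" "second_kind (form_coeff \<alpha>)"
    using form_coeff[of \<alpha>] by auto
  show n: "form_coeff \<alpha> k nicely_meromorphic_on UNIV" and "form_coeff \<alpha> k meromorphic_on UNIV"
    "t \<noteq> 0 \<Longrightarrow> form_coeff \<alpha> Std t = - form_coeff \<alpha> AtInf (1 / t) / t ^ 2"
    "residue (form_coeff \<alpha> k) t = 0"
    using * by (auto simp: meromorphic_form_def second_kind_def nicely_meromorphic_on_def)
  show "remove_sings (form_coeff \<alpha> k) = form_coeff \<alpha> k"
  proof
    fix t
    from n have "(is_pole (form_coeff \<alpha> k) t \<and> form_coeff \<alpha> k t = 0) \<or> form_coeff \<alpha> k \<midarrow>t\<rightarrow> form_coeff \<alpha> k t"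
      by (auto simp: nicely_meromorphic_on_def)
    then show "remove_sings (form_coeff \<alpha> k) t = form_coeff \<alpha> k t"
      by auto
  qed
qed

lemma coeff_iso: "isolated_singularity_at (form_coeff \<alpha> k) t"
  using coeff_props(2) by (metis UNIV_I meromorphic_on_isolated_singularity
        meromorphic_on_subset subset_UNIV)

lemma kform_eqI:
  assumes "\<And>k t. \<forall>\<^sub>F s in at t. form_coeff \<alpha> k s = form_coeff \<beta> k s"
  shows "\<alpha> = \<beta>"
proof -
  have "remove_sings (form_coeff \<alpha> k) t = remove_sings (form_coeff \<beta> k) t" for k t
    using assms[where k = k and t = t] by (intro remove_sings_cong) auto
  then have "form_coeff \<alpha> k t = form_coeff \<beta> k t" for k t
    by (simp add: coeff_props(5))
  then have "form_coeff \<alpha> = form_coeff \<beta>" by (intro ext)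
  then show ?thesis by (simp add: form_coeff_inject)
qed

lemma eventually_coeff_mk_form:
  assumes mero: "\<And>k. \<phi> k meromorphic_on UNIV"
    and trans: "\<And>t. t \<noteq> 0 \<Longrightarrow> \<forall>\<^sub>F s in at t. \<phi> Std s = - \<phi> AtInf (1 / s) / s ^ 2"
    and res: "\<And>k t. residue (\<phi> k) t = 0"
  shows "\<forall>\<^sub>F s in at t. form_coeff (mk_form \<phi>) k s = \<phi> k s"
proof -
  have "isolated_singularity_at (\<phi> k) t"
    using mero by (metis UNIV_I meromorphic_on_isolated_singularity
        meromorphic_on_subset subset_UNIV)
  then show ?thesis
    using coeff_mk_form[of \<phi> k, OF mero trans res] eventually_remove_sings_eq_at by simp
qed

lemma ev_lincomb:
  "\<forall>\<^sub>F s in at t. form_coeff (mk_form (\<lambda>k t. a * form_coeff \<alpha> k t + b * form_coeff \<beta> k t)) k s =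
     a * form_coeff \<alpha> k s + b * form_coeff \<beta> k s"
proof (rule eventually_coeff_mk_form)
  show "(\<lambda>t. a * form_coeff \<alpha> k t + b * form_coeff \<beta> k t) meromorphic_on UNIV" for k
    by (intro meromorphic_intros coeff_props)
  show "\<forall>\<^sub>F s in at t. a * form_coeff \<alpha> Std s + b * form_coeff \<beta> Std s =
          - (a * form_coeff \<alpha> AtInf (1 / s) + b * form_coeff \<beta> AtInf (1 / s)) / s ^ 2" if "t \<noteq> 0" for t
  proof -
    have "\<forall>\<^sub>F s in at t. s \<noteq> 0"
      using that by (simp add: eventually_neq_at_within)
    then show ?thesis
      by eventually_elim (simp add: coeff_props(3) field_simps)
  qed
  show "residue (\<lambda>t. a * form_coeff \<alpha> k t + b * form_coeff \<beta> k t) t = 0" for k t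
  proof -
    obtain F where F: "(\<lambda>w. form_coeff \<alpha> k (t + w)) has_laurent_expansion F"
      using meromorphic_on_imp_has_laurent_expansion[OF coeff_props(2) UNIV_I] by blast
    obtain G where G: "(\<lambda>w. form_coeff \<beta> k (t + w)) has_laurent_expansion G"
      using meromorphic_on_imp_has_laurent_expansion[OF coeff_props(2) UNIV_I] by blast
    have "(\<lambda>w. a * form_coeff \<alpha> k (t + w) + b * form_coeff \<beta> k (t + w)) has_laurent_expansion
            fls_const a * F + fls_const b * G"
      by (intro laurent_expansion_intros F G)
    then have "residue (\<lambda>t. a * form_coeff \<alpha> k t + b * form_coeff \<beta> k t) t =
        fls_residue (fls_const a * F + fls_const b * G)"
      by (rule has_laurent_expansion_residue)
    also have "\<dots> = a * fls_residue F + b * fls_residue G" by simp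
    also have "\<dots> = 0"
      using has_laurent_expansion_residue[OF F] has_laurent_expansion_residue[OF G]
      by (simp add: coeff_props(4))
    finally show ?thesis .
  qed
qed

lemma ev_add: "\<forall>\<^sub>F s in at t. form_coeff (mk_form (\<lambda>k t. form_coeff \<alpha> k t + form_coeff \<beta> k t)) k s =
     form_coeff \<alpha> k s + form_coeff \<beta> k s"
  using ev_lincomb[of 1 \<alpha> 1 \<beta> k t] by simp

lemma ev_diff: "\<forall>\<^sub>F s in at t. form_coeff (mk_form (\<lambda>k t. form_coeff \<alpha> k t - form_coeff \<beta> k t)) k s =
     form_coeff \<alpha> k s - form_coeff \<beta> k s"
  using ev_lincomb[of 1 \<alpha> "-1" \<beta> k t] by simp

lemma ev_scale: "\<forall>\<^sub>F s in at t. form_coeff (mk_form (\<lambda>k t. c * form_coeff \<alpha> k t)) k s = c * form_coeff \<alpha> k s"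
  using ev_lincomb[of c \<alpha> 0 \<alpha> k t] by simp

lemma ev_uminus: "\<forall>\<^sub>F s in at t. form_coeff (mk_form (\<lambda>k t. - form_coeff \<alpha> k t)) k s = - form_coeff \<alpha> k s"
  using ev_lincomb[of "-1" \<alpha> 0 \<alpha> k t] by simp

lemma ev_zero: "\<forall>\<^sub>F s in at t. form_coeff (mk_form (\<lambda>_ _. 0)) k s = 0"
  using ev_lincomb[of 0 undefined 0 undefined k t] by simp

instantiation kform :: ab_group_add
begin
definition zero_kform :: kform where "0 = mk_form (\<lambda>_ _. 0)"
definition plus_kform :: "kform \<Rightarrow> kform \<Rightarrow> kform" where
  "\<alpha> + \<beta> = mk_form (\<lambda>k t. form_coeff \<alpha> k t + form_coeff \<beta> k t)"
definition uminus_kform :: "kform \<Rightarrow> kform" where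
  "- \<alpha> = mk_form (\<lambda>k t. - form_coeff \<alpha> k t)"
definition minus_kform :: "kform \<Rightarrow> kform \<Rightarrow> kform" where
  "\<alpha> - \<beta> = mk_form (\<lambda>k t. form_coeff \<alpha> k t - form_coeff \<beta> k t)"
instance
proof
  fix \<alpha> \<beta> \<gamma> :: kform
  show "\<alpha> + \<beta> + \<gamma> = \<alpha> + (\<beta> + \<gamma>)"
  proof (rule kform_eqI)
    fix k t
    show "\<forall>\<^sub>F s in at t. form_coeff (\<alpha> + \<beta> + \<gamma>) k s = form_coeff (\<alpha> + (\<beta> + \<gamma>)) k s"
      unfolding plus_kform_def
      using ev_add[of \<alpha> \<beta> k t] ev_add[of "mk_form (\<lambda>k t. form_coeff \<alpha> k t + form_coeff \<beta> k t)" \<gamma> k t]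
        ev_add[of \<beta> \<gamma> k t] ev_add[of \<alpha> "mk_form (\<lambda>k t. form_coeff \<beta> k t + form_coeff \<gamma> k t)" k t]
      by eventually_elim simp
  qed
  show "\<alpha> + \<beta> = \<beta> + \<alpha>" by (simp add: plus_kform_def add.commute)
  show "0 + \<alpha> = \<alpha>"
  proof (rule kform_eqI)
    fix k t
    show "\<forall>\<^sub>F s in at t. form_coeff (0 + \<alpha>) k s = form_coeff \<alpha> k s"
      unfolding plus_kform_def zero_kform_def
      using ev_add[of "mk_form (\<lambda>_ _. 0)" \<alpha> k t] ev_zero[of k t] by eventually_elim simp
  qed
  show "- \<alpha> + \<alpha> = 0"
  proof (rule kform_eqI)
    fix k t
    show "\<forall>\<^sub>F s in at t. form_coeff (- \<alpha> + \<alpha>) k s = form_coeff 0 k s"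
      unfolding plus_kform_def zero_kform_def uminus_kform_def
      using ev_add[of "mk_form (\<lambda>k t. - form_coeff \<alpha> k t)" \<alpha> k t] ev_zero[of k t] ev_uminus[of \<alpha> k t]
      by eventually_elim simp
  qed
  show "\<alpha> - \<beta> = \<alpha> + - \<beta>"
  proof (rule kform_eqI)
    fix k t
    show "\<forall>\<^sub>F s in at t. form_coeff (\<alpha> - \<beta>) k s = form_coeff (\<alpha> + - \<beta>) k s"
      unfolding plus_kform_def minus_kform_def uminus_kform_def
      using ev_add[of \<alpha> "mk_form (\<lambda>k t. - form_coeff \<beta> k t)" k t] ev_uminus[of \<beta> k t]
        ev_diff[of \<alpha> \<beta> k t]
      by eventually_elim simp
  qed
qed
end

lemma coeff_plus: "\<forall>\<^sub>F s in at t. form_coeff (\<alpha> + \<beta>) k s = form_coeff \<alpha> k s + form_coeff \<beta> k s"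
  unfolding plus_kform_def by (rule ev_add)

definition scale_form :: "complex \<Rightarrow> kform \<Rightarrow> kform" where
  "scale_form c \<alpha> = mk_form (\<lambda>k t. c * form_coeff \<alpha> k t)"

lemma coeff_scale_form: "\<forall>\<^sub>F s in at t. form_coeff (scale_form c \<alpha>) k s = c * form_coeff \<alpha> k s"
  unfolding scale_form_def by (rule ev_scale)

lemma vector_space_scale_form: "vector_space scale_form"
proof
  fix a b \<alpha> \<beta>
  show "scale_form a (\<alpha> + \<beta>) = scale_form a \<alpha> + scale_form a \<beta>"
  proof (rule kform_eqI)
    fix k t
    show "\<forall>\<^sub>F s in at t. form_coeff (scale_form a (\<alpha> + \<beta>)) k s =
            form_coeff (scale_form a \<alpha> + scale_form a \<beta>) k s"
      using coeff_scale_form[of a "\<alpha> + \<beta>" k t] coeff_plus[of \<alpha> \<beta> k t]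
        coeff_plus[of "scale_form a \<alpha>" "scale_form a \<beta>" k t]
        coeff_scale_form[of a \<alpha> k t] coeff_scale_form[of a \<beta> k t]
      by eventually_elim (simp add: algebra_simps)
  qed
  show "scale_form (a + b) \<alpha> = scale_form a \<alpha> + scale_form b \<alpha>"
  proof (rule kform_eqI)
    fix k t
    show "\<forall>\<^sub>F s in at t. form_coeff (scale_form (a + b) \<alpha>) k s =
            form_coeff (scale_form a \<alpha> + scale_form b \<alpha>) k s"
      using coeff_scale_form[of "a + b" \<alpha> k t]
        coeff_plus[of "scale_form a \<alpha>" "scale_form b \<alpha>" k t]
        coeff_scale_form[of a \<alpha> k t] coeff_scale_form[of b \<alpha> k t]
      by eventually_elim (simp add: algebra_simps)
  qed
  show "scale_form a (scale_form b \<alpha>) = scale_form (a * b) \<alpha>"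
  proof (rule kform_eqI)
    fix k t
    show "\<forall>\<^sub>F s in at t. form_coeff (scale_form a (scale_form b \<alpha>)) k s = form_coeff (scale_form (a * b) \<alpha>) k s"
      using coeff_scale_form[of "a * b" \<alpha> k t] coeff_scale_form[of a "scale_form b \<alpha>" k t]
        coeff_scale_form[of b \<alpha> k t]
      by eventually_elim (simp add: algebra_simps)
  qed
  show "scale_form 1 \<alpha> = \<alpha>"
  proof (rule kform_eqI)
    fix k t
    show "\<forall>\<^sub>F s in at t. form_coeff (scale_form 1 \<alpha>) k s = form_coeff \<alpha> k s"
      using coeff_scale_form[of 1 \<alpha> k t] by eventually_elim simp
  qed
qed

definition regular_at :: "kform \<Rightarrow> pline \<Rightarrow> bool" where
  "regular_at \<alpha> p \<longleftrightarrow> (\<forall>k t. chart k t = p \<longrightarrow> \<not> is_pole (form_coeff \<alpha> k) t)"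

text \<open>Everywhere below a coordinate \<open>u\<close> is used to trivialise \<open>K\<close> by \<open>du\<close> at the points where \<open>u\<close>
  is regular. So \<open>form_value u \<alpha> p\<close> stands for the number \<open>c\<close> with \<open>\<alpha>(p) = c du\<^sub>p\<close>, and an element
  of \<open>W \<otimes> K\<^sub>z\<^sup>n\<close> is represented by its coefficient of \<open>(du\<^sub>z)\<^sup>n\<close>, which is an element of \<open>W\<close>.\<close>

fun form_value :: "(pline \<Rightarrow> complex) \<Rightarrow> kform \<Rightarrow> pline \<Rightarrow> complex" where
  "form_value u \<alpha> (Aff t) = form_coeff \<alpha> Std t / deriv (\<lambda>s. u (chart Std s)) t"
| "form_value u \<alpha> Infty = form_coeff \<alpha> AtInf 0 / deriv (\<lambda>s. u (chart AtInf s)) 0"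

text \<open>\<open>e_form u z\<close> is the form \<open>- du / (u - u(z))\<^sup>2\<close>.\<close>

definition e_form :: "(pline \<Rightarrow> complex) \<Rightarrow> pline \<Rightarrow> kform" where
  "e_form u z =
     mk_form (\<lambda>k t. - deriv (\<lambda>s. u (chart k s)) t / (u (chart k t) - u z) ^ 2)"

lemma coeff_e_form:
  assumes "meromorphic_fun u"
  shows "form_coeff (e_form u z) k =
     remove_sings (\<lambda>t. - deriv (\<lambda>s. u (chart k s)) t / (u (chart k t) - u z) ^ 2)"
  unfolding e_form_def
proof (rule coeff_mk_form)
  let ?\<phi> = "\<lambda>k t. - deriv (\<lambda>s. u (chart k s)) t / (u (chart k t) - u z) ^ 2"
  have mero: "(\<lambda>s. u (chart k s)) meromorphic_on UNIV" for k
    using assms by (auto simp: meromorphic_fun_def nicely_meromorphic_on_def)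
  have an: "\<forall>\<^sub>F s in at t. (\<lambda>s. u (chart k s)) analytic_on {s}" for k t
    using mero by (metis UNIV_I eventually_cosparse_imp_eventually_at
        meromorphic_on_imp_analytic_cosparse)
  show "?\<phi> k meromorphic_on UNIV" for k
    by (intro meromorphic_intros mero)
  show "\<forall>\<^sub>F s in at t. ?\<phi> Std s = - ?\<phi> AtInf (1 / s) / s ^ 2" if "t \<noteq> 0" for t
  proof -
    have ev0: "\<forall>\<^sub>F s in at t. s \<noteq> 0"
      using that by (simp add: eventually_neq_at_within)
    have ev1: "\<forall>\<^sub>F s in at t. (\<lambda>s. u (chart AtInf s)) analytic_on {1 / s}"
      using an[of AtInf "1 / t"] unfolding filtermap_inverse_at[OF that, symmetric]
      by (simp add: eventually_filtermap)
    show ?thesis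
      using ev0 ev1
    proof eventually_elim
      case (elim s)
      let ?g = "\<lambda>s. u (chart AtInf s)"
      have g: "(?g has_field_derivative deriv ?g (1 / s)) (at (1 / s))"
        using elim(2) by (simp add: analytic_on_imp_differentiable_at DERIV_deriv_iff_field_differentiable)
      have i: "((\<lambda>s. 1 / s) has_field_derivative (- 1 / s ^ 2)) (at s)"
        using elim(1) by (auto intro!: derivative_eq_intros simp: power2_eq_square)
      have "((\<lambda>s. ?g (1 / s)) has_field_derivative deriv ?g (1 / s) * (- 1 / s ^ 2)) (at s)"
        using DERIV_chain2[OF g i] .
      moreover have "\<forall>\<^sub>F r in nhds s. ?g (1 / r) = u (chart Std r)"
        using t1_space_nhds[OF elim(1)] by eventually_elim simp
      ultimately have "((\<lambda>r. u (chart Std r)) has_field_derivative deriv ?g (1 / s) * (- 1 / s ^ 2)) (at s)"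
        by (subst (asm) DERIV_cong_ev[OF refl _ refl])
      then have "deriv (\<lambda>r. u (chart Std r)) s = deriv ?g (1 / s) * (- 1 / s ^ 2)"
        by (rule DERIV_imp_deriv)
      then show ?case using elim(1) by simp
    qed
  qed
  show "residue (?\<phi> k) t = 0" for k t
  proof (cases "\<forall>\<^sub>F s in at t. u (chart k s) - u z \<noteq> 0")
    case False
    let ?h = "\<lambda>s. u (chart k s) - u z"
    have "?h meromorphic_on {t}"
      by (intro meromorphic_intros meromorphic_on_subset[OF mero]) auto
    then have "\<forall>\<^sub>F s in at t. ?h s = 0"
      using False not_essential_frequently_0_imp_eventually_0[of ?h t]
      by (simp add: meromorphic_at_iff frequently_def)
    then have "\<forall>\<^sub>F s in at t. ?\<phi> k s = 0"
      by eventually_elim simp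
    then have "residue (?\<phi> k) t = residue (\<lambda>_. 0) t"
      by (intro residue_cong) auto
    then show ?thesis by (simp add: residue_const)
  next
    case True
    let ?h = "\<lambda>s. inverse (u (chart k s) - u z)"
    have "?h meromorphic_on UNIV"
      by (intro meromorphic_intros mero)
    then obtain F where F: "(\<lambda>w. ?h (t + w)) has_laurent_expansion F"
      using meromorphic_on_imp_has_laurent_expansion UNIV_I by blast
    have "(\<lambda>w. deriv ?h (t + w)) has_laurent_expansion fls_deriv F"
    proof -
      have "deriv f (t + w) = deriv (\<lambda>x. f (t + x)) w" for f :: "complex \<Rightarrow> complex" and w
        unfolding deriv_shift_0[of f "t + w"] deriv_shift_0[of "\<lambda>x. f (t + x)" w]
        by (simp add: o_def add.assoc)
      then show ?thesis
        using has_laurent_expansion_deriv[OF F] by simp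
    qed
    then have "residue (deriv ?h) t = 0"
      by (simp add: has_laurent_expansion_residue fls_residue_deriv)
    moreover have "\<forall>\<^sub>F s in at t. ?\<phi> k s = deriv ?h s"
      using True an[of k t]
    proof eventually_elim
      case (elim s)
      have "((\<lambda>s. u (chart k s)) has_field_derivative deriv (\<lambda>s. u (chart k s)) s) (at s)"
        using elim(2) by (simp add: analytic_on_imp_differentiable_at DERIV_deriv_iff_field_differentiable)
      then have "(?h has_field_derivative ?\<phi> k s) (at s)"
        using elim(1) by (auto intro!: derivative_eq_intros simp: power2_eq_square field_simps)
      then show ?case by (simp add: DERIV_imp_deriv)
    qed
    then have "residue (?\<phi> k) t = residue (deriv ?h) t"
      by (intro residue_cong) auto
    ultimately show ?thesis by simp
  qed
qed


section \<open>The symmetric algebra\<close>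

text \<open>\<open>W\<close> is the symmetric algebra of the complex vector space \<open>K\<close> of all forms of type
  \<^typ>\<open>kform\<close>: the polynomial algebra with one indeterminate \<open>X\<^sub>\<alpha>\<close> for each form \<open>\<alpha>\<close> (monomials are
  finite multisets of forms), modulo the ideal that makes \<open>\<alpha> \<mapsto> X\<^sub>\<alpha>\<close> linear. The span below is
  taken in the polynomial ring as a module over itself, so it is the ideal generated.\<close>

type_synonym form_poly = "kform multiset \<Rightarrow>\<^sub>0 complex"

definition indet :: "kform \<Rightarrow> form_poly" where
  "indet \<alpha> = Poly_Mapping.single {#\<alpha>#} 1"

definition poly_const :: "complex \<Rightarrow> form_poly" where
  "poly_const c = Poly_Mapping.single {#} c"

definition linear_relators :: "form_poly set" where
  "linear_relators =
     {indet (\<alpha> + \<beta>) - indet \<alpha> - indet \<beta> | \<alpha> \<beta>. True} \<union>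
     {indet (scale_form c \<alpha>) - poly_const c * indet \<alpha> | c \<alpha>. True}"

definition sym_ideal :: "form_poly set" where
  "sym_ideal = module.span (*) linear_relators"

lemma module_mult: "module ((*) :: 'a::comm_ring_1 \<Rightarrow> 'a \<Rightarrow> 'a)"
  by unfold_locales (auto simp: algebra_simps)

definition sym_rel :: "form_poly \<Rightarrow> form_poly \<Rightarrow> bool" where
  "sym_rel p q \<longleftrightarrow> p - q \<in> sym_ideal"

lemma sym_ideal_zero: "0 \<in> sym_ideal"
  and sym_ideal_add: "p \<in> sym_ideal \<Longrightarrow> q \<in> sym_ideal \<Longrightarrow> p + q \<in> sym_ideal"
  and sym_ideal_mult: "p \<in> sym_ideal \<Longrightarrow> r * p \<in> sym_ideal"
  and sym_ideal_uminus: "p \<in> sym_ideal \<Longrightarrow> - p \<in> sym_ideal"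
  unfolding sym_ideal_def
  by (simp_all add: module.span_zero[OF module_mult] module.span_add[OF module_mult]
      module.span_scale[OF module_mult] module.span_neg[OF module_mult])

quotient_type fock = form_poly / sym_rel
proof (rule equivpI)
  show "reflp sym_rel" by (auto intro!: reflpI simp: sym_rel_def sym_ideal_zero)
  show "symp sym_rel"
    by (rule sympI) (use sym_ideal_uminus in \<open>force simp: sym_rel_def\<close>)
  show "transp sym_rel"
    by (rule transpI) (use sym_ideal_add in \<open>force simp: sym_rel_def\<close>)
qed

lemma lookup_mult_empty:
  fixes p q :: form_poly
  shows "Poly_Mapping.lookup (p * q) {#} = Poly_Mapping.lookup p {#} * Poly_Mapping.lookup q {#}"
proof -
  have "Poly_Mapping.lookup (p * q) {#} =
      (\<Sum>a. Poly_Mapping.lookup p a * (\<Sum>b. Poly_Mapping.lookup q b when {#} = a + b))"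
    by (simp add: lookup_mult)
  also have "\<dots> = (\<Sum>a. (Poly_Mapping.lookup p a * Poly_Mapping.lookup q {#}) when a = {#})"
  proof (rule arg_cong[where f = Sum_any], rule ext)
    fix a
    have "(\<lambda>b. Poly_Mapping.lookup q b when {#} = a + b) =
        (\<lambda>b. (Poly_Mapping.lookup q {#} when a = {#}) when b = {#})"
      by (auto simp: fun_eq_iff when_def)
    then show "Poly_Mapping.lookup p a * (\<Sum>b. Poly_Mapping.lookup q b when {#} = a + b) =
        (Poly_Mapping.lookup p a * Poly_Mapping.lookup q {#} when a = {#})"
      by (simp add: when_def)
  qed
  also have "\<dots> = Poly_Mapping.lookup p {#} * Poly_Mapping.lookup q {#}" by simp
  finally show ?thesis .
qed

lemma one_notin_sym_ideal: "1 \<notin> sym_ideal"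
proof -
  have "Poly_Mapping.lookup p {#} = 0" if "p \<in> sym_ideal" for p
    using that unfolding sym_ideal_def
  proof (rule module.span_induct_alt[OF module_mult])
    show "Poly_Mapping.lookup (0 :: form_poly) {#} = 0" by (rule lookup_zero)
    show "Poly_Mapping.lookup (c * x + y) {#} = 0" if "x \<in> linear_relators" "Poly_Mapping.lookup y {#} = 0"
      for c x y :: form_poly
      using that by (auto simp: linear_relators_def lookup_add lookup_minus lookup_mult_empty
          indet_def lookup_single)
  qed
  then show ?thesis by (metis lookup_one zero_neq_one when_simps(1) zero_multiset_def)
qed

instantiation fock :: comm_ring_1
begin
lift_definition zero_fock :: fock is 0 .
lift_definition one_fock :: fock is 1 .
lift_definition plus_fock :: "fock \<Rightarrow> fock \<Rightarrow> fock" is "(+)"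
  unfolding sym_rel_def by (metis add_diff_add sym_ideal_add)
lift_definition uminus_fock :: "fock \<Rightarrow> fock" is "uminus"
  unfolding sym_rel_def by (metis minus_diff_minus sym_ideal_uminus)
lift_definition minus_fock :: "fock \<Rightarrow> fock \<Rightarrow> fock" is "(-)"
proof -
  fix a b c d assume "sym_rel a b" "sym_rel c d"
  then have "(a - b) + - (c - d) \<in> sym_ideal"
    unfolding sym_rel_def by (intro sym_ideal_add sym_ideal_uminus)
  then show "sym_rel (a - c) (b - d)"
    by (simp add: sym_rel_def algebra_simps)
qed
lift_definition times_fock :: "fock \<Rightarrow> fock \<Rightarrow> fock" is "(*)"
proof -
  fix a b c d assume "sym_rel a b" "sym_rel c d"
  then have "c * (a - b) + b * (c - d) \<in> sym_ideal"
    unfolding sym_rel_def by (intro sym_ideal_add sym_ideal_mult)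
  then show "sym_rel (a * c) (b * d)"
    by (simp add: sym_rel_def algebra_simps)
qed
instance
proof
  fix a b c :: fock
  show "a * b * c = a * (b * c)" "a * b = b * a" "1 * a = a"
    "a + b + c = a + (b + c)" "a + b = b + a" "0 + a = a" "- a + a = 0" "a - b = a + - b"
    "(a + b) * c = a * c + b * c"
    by (transfer; simp add: sym_rel_def sym_ideal_zero algebra_simps)+
  show "(0 :: fock) \<noteq> 1"
  proof
    assume "(0 :: fock) = 1"
    then have "- (0 - 1) \<in> sym_ideal"
      by (transfer; unfold sym_rel_def) (rule sym_ideal_uminus)
    then show False using one_notin_sym_ideal by simp
  qed
qed
end

lift_definition scalar :: "complex \<Rightarrow> fock" is poly_const .

lift_definition embed :: "kform \<Rightarrow> fock" is indet .

text \<open>\<open>W_on X\<close> is the symmetric algebra of the space of forms that are regular at all points of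
  \<open>X\<close>, as a subalgebra of \<open>W\<close>; the space \<open>W\<^sup>z\<close> is \<open>W_on {z}\<close>.\<close>

inductive_set W_on :: "pline set \<Rightarrow> fock set" for X :: "pline set" where
  W_on_scalar: "scalar c \<in> W_on X"
| W_on_embed: "(\<And>p. p \<in> X \<Longrightarrow> regular_at \<alpha> p) \<Longrightarrow> embed \<alpha> \<in> W_on X"
| W_on_add: "v \<in> W_on X \<Longrightarrow> w \<in> W_on X \<Longrightarrow> v + w \<in> W_on X"
| W_on_mult: "v \<in> W_on X \<Longrightarrow> w \<in> W_on X \<Longrightarrow> v * w \<in> W_on X"


section \<open>The fields, trivialised by \<open>du\<close>\<close>

definition e_field :: "(pline \<Rightarrow> complex) \<Rightarrow> pline \<Rightarrow> fock \<Rightarrow> fock" where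
  "e_field u z w = embed (e_form u z) * w"

definition linear_on_fock :: "fock set \<Rightarrow> (fock \<Rightarrow> 'a::ab_group_add) \<Rightarrow> (complex \<Rightarrow> 'a \<Rightarrow> 'a) \<Rightarrow> bool" where
  "linear_on_fock A D sc \<longleftrightarrow>
     (\<forall>v\<in>A. \<forall>w\<in>A. D (v + w) = D v + D w) \<and>
     (\<forall>c. \<forall>w\<in>A. D (scalar c * w) = sc c (D w))"

text \<open>\<open>i(z)\<close> is only defined on \<open>W\<^sup>z\<close>; the value 0 elsewhere makes the description unique.\<close>

definition i_field :: "(pline \<Rightarrow> complex) \<Rightarrow> pline \<Rightarrow> fock \<Rightarrow> fock" where
  "i_field u z = (THE D.
     (\<forall>w. w \<notin> W_on {z} \<longrightarrow> D w = 0) \<and>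
     (\<forall>w\<in>W_on {z}. D w \<in> W_on {z}) \<and>
     linear_on_fock (W_on {z}) D (\<lambda>c w. scalar c * w) \<and>
     (\<forall>v\<in>W_on {z}. \<forall>w\<in>W_on {z}. D (v * w) = D v * w + v * D w) \<and>
     D 1 = 0 \<and>
     (\<forall>\<alpha>. regular_at \<alpha> z \<longrightarrow> D (embed \<alpha>) = scalar (- form_value u \<alpha> z)))"

definition b_field :: "(pline \<Rightarrow> complex) \<Rightarrow> pline \<Rightarrow> fock \<Rightarrow> fock" where
  "b_field u z w = i_field u z w + e_field u z w"

definition T_field :: "(pline \<Rightarrow> complex) \<Rightarrow> pline \<Rightarrow> fock \<Rightarrow> fock" where
  "T_field u z w = scalar (1 / 2) *
     (i_field u z (i_field u z w) + e_field u z (e_field u z w) + 2 * e_field u z (i_field u z w))"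

definition S_field :: "(pline \<Rightarrow> complex) \<Rightarrow> pline \<Rightarrow> fock \<Rightarrow> fock" where
  "S_field u z w =
     e_field u z (e_field u z (e_field u z w))
     + 3 * e_field u z (e_field u z (i_field u z w))
     + 3 * e_field u z (i_field u z (i_field u z w))
     + i_field u z (i_field u z (i_field u z w))"

definition omega :: "(pline \<Rightarrow> complex) \<Rightarrow> pline \<Rightarrow> pline \<Rightarrow> complex" where
  "omega u z\<^sub>2 z\<^sub>1 = 1 / (u z\<^sub>2 - u z\<^sub>1) ^ 2"


section \<open>Polydifferentials and limits\<close>

text \<open>The degree \<open>m\<close> component of \<open>w\<close>, viewed as a symmetric polydifferential and evaluated at the
  points \<open>x 0, \<dots>, x (m - 1)\<close> (again trivialised by \<open>du\<close>): it sends a product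
  \<open>\<alpha>\<^sub>0 \<cdots> \<alpha>\<^sub>m\<^sub>-\<^sub>1\<close> of forms to \<open>\<Sum>\<^sub>\<sigma> \<Prod>\<^sub>i \<alpha>\<^sub>\<sigma>\<^sub>(\<^sub>i\<^sub>)(x i)\<close>, and products of another
  number of forms to 0. It is defined when all forms involved are regular at the points.\<close>

definition polydiff ::
  "(pline \<Rightarrow> complex) \<Rightarrow> nat \<Rightarrow> (nat \<Rightarrow> pline) \<Rightarrow> fock \<Rightarrow> complex" where
  "polydiff u m x = (let X = x ` {..<m} in THE L.
     (\<forall>w. w \<notin> W_on X \<longrightarrow> L w = 0) \<and>
     linear_on_fock (W_on X) L (*) \<and>
     (\<forall>n \<alpha>. (\<forall>j<n. \<forall>p\<in>X. regular_at (\<alpha> j) p) \<longrightarrow>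
        L (\<Prod>j<n. embed (\<alpha> j)) =
          (if n = m then \<Sum>\<sigma> | \<sigma> permutes {..<m}. \<Prod>i<m. form_value u (\<alpha> (\<sigma> i)) (x i) else 0)))"

inductive_set poly_funs :: "nat \<Rightarrow> ((nat \<Rightarrow> complex) \<Rightarrow> complex) set" for n :: nat where
  poly_funs_const: "(\<lambda>_. c) \<in> poly_funs n"
| poly_funs_var: "i < n \<Longrightarrow> (\<lambda>y. y i) \<in> poly_funs n"
| poly_funs_add: "P \<in> poly_funs n \<Longrightarrow> Q \<in> poly_funs n \<Longrightarrow> (\<lambda>y. P y + Q y) \<in> poly_funs n"
| poly_funs_mult: "P \<in> poly_funs n \<Longrightarrow> Q \<in> poly_funs n \<Longrightarrow> (\<lambda>y. P y * Q y) \<in> poly_funs n"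

text \<open>\<open>limit_at u z\<^sub>1 D E s\<close>: the family \<open>E z\<close> of elements of \<open>W\<close>, which is meaningful for
  \<open>z \<in> D\<close>, \<open>z \<noteq> z\<^sub>1\<close>, tends to \<open>s\<close> as \<open>z \<rightarrow> z\<^sub>1\<close>. There is a Zariski (that is, cofinite)
  neighbourhood \<open>N\<close> of \<open>z\<^sub>1\<close> such that for each \<open>m\<close> one rational function \<open>P / Q\<close> in \<open>m + 1\<close>
  variables, the first being \<open>u(z)\<close> and the others \<open>u(x 0), \<dots>, u(x (m - 1))\<close>, gives the degree
  \<open>m\<close> components of \<open>E z\<close> for \<open>z \<in> N\<close>, \<open>z \<noteq> z\<^sub>1\<close> and of \<open>s\<close> for \<open>z = z\<^sub>1\<close>. The
  denominator does not vanish identically in \<open>x\<close> for any \<open>z \<in> N\<close>; for \<open>z = z\<^sub>1\<close> this says that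
  \<open>P / Q\<close> has no pole along \<open>z = z\<^sub>1\<close>, so that it can be restricted.\<close>

definition limit_at ::
  "(pline \<Rightarrow> complex) \<Rightarrow> pline \<Rightarrow> pline set \<Rightarrow> (pline \<Rightarrow> fock) \<Rightarrow> fock \<Rightarrow> bool" where
  "limit_at u z\<^sub>1 D E s \<longleftrightarrow>
     (\<exists>N. finite (- N) \<and> z\<^sub>1 \<in> N \<and> N - {z\<^sub>1} \<subseteq> D \<and> (\<forall>z\<in>N. \<not> has_pole_at u z) \<and>
       (\<forall>m. \<exists>P\<in>poly_funs (Suc m). \<exists>Q\<in>poly_funs (Suc m). \<forall>z\<in>N.
          (\<exists>y. Q (y(0 := u z)) \<noteq> 0) \<and>
          (\<forall>x. (\<forall>i<m. \<not> has_pole_at u (x i)) \<longrightarrow>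
             (let y = case_nat (u z) (\<lambda>i. u (x i)); w = (E(z\<^sub>1 := s)) z
              in Q y \<noteq> 0 \<longrightarrow> w \<in> W_on (x ` {..<m}) \<and> polydiff u m x w = P y / Q y))))"

end

theory Submission
  imports Defs
begin

text \<open>The proof is a Wick contraction followed by a rationality argument.

  Write \<open>\<omega> = 1 / (u z - u z\<^sub>1)\<^sup>2\<close>. Since \<open>i(z)\<close> is a derivation and sends \<open>e(z\<^sub>1)\<close> to the scalar \<open>\<omega>\<close>,
  moving \<open>i(z)\<close> to the right through \<open>2 T(z\<^sub>1) = i(z\<^sub>1)\<^sup>2 + e(z\<^sub>1)\<^sup>2 + 2 e(z\<^sub>1) i(z\<^sub>1)\<close> produces the
  contraction terms \<open>2 \<omega> (e(z\<^sub>1) + i(z\<^sub>1)) = 2 \<omega> b(z\<^sub>1)\<close> and otherwise only the normally ordered product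
  \<open>i(z) i(z\<^sub>1)\<^sup>2 + e(z\<^sub>1)\<^sup>2 i(z) + 2 e(z\<^sub>1) i(z) i(z\<^sub>1) + e(z) (i(z\<^sub>1)\<^sup>2 + e(z\<^sub>1)\<^sup>2 + 2 e(z\<^sub>1) i(z\<^sub>1))\<close>.
  So for \<open>z \<noteq> z\<^sub>1\<close> the expression of the theorem is this product applied to \<open>v\<close> (\<open>bT_contraction\<close>). The
  product still makes sense at \<open>z = z\<^sub>1\<close>, where it is \<open>S(z\<^sub>1)\<close> (\<open>bT_normal_ordered_diagonal\<close>).

  It remains to see that the components of the normally ordered product are rational functions without a
  pole along \<open>z = z\<^sub>1\<close>. The vector \<open>v\<close> involves finitely many forms, so it lies in the symmetric algebra
  of the forms regular on a cofinite set \<open>N\<close> containing \<open>z\<^sub>1\<close>. By Liouville's theorem a form is a rational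
  function of a chart variable times the differential of that variable, and a coordinate is a Moebius
  function of it; hence the value of a form regular on \<open>N\<close> is a rational function of \<open>u\<close> whose
  denominator vanishes at no point of \<open>N\<close> (\<open>form_value_rational\<close>). Therefore the normally ordered
  product is a finite sum of terms \<open>r(u z) a\<^sub>1(z) \<cdots> a\<^sub>n(z)\<close>, where \<open>r\<close> is rational without poles on
  \<open>N\<close> and each form \<open>a\<^sub>j(z)\<close>, evaluated at \<open>p\<close>, is rational in \<open>(u z, u p)\<close>
  (\<open>bT_normal_ordered_family\<close>). The polydifferential of such a term is \<open>r\<close> times a permanent of these
  values (\<open>polydiff_rational\<close>).

  The operator \<open>i_field\<close> and the functional \<open>polydiff\<close> are given by descriptions, so their existence and
  uniqueness have to be proved. Both are obtained from derivations of the symmetric algebra, which come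
  from its universal property.\<close>


section \<open>Ring homomorphisms and derivations of the symmetric algebra\<close>

text \<open>The value of a polynomial in the indeterminates \<open>X\<^sub>\<alpha>\<close> at \<open>X\<^sub>\<alpha> = f \<alpha>\<close>, with the scalars mapped to
  the target ring by \<open>c\<close>.\<close>

definition poly_eval :: "(complex \<Rightarrow> 'r) \<Rightarrow> (kform \<Rightarrow> 'r) \<Rightarrow> form_poly \<Rightarrow> 'r::comm_ring_1" where
  "poly_eval c f p = (\<Sum>M\<in>Poly_Mapping.keys p. c (Poly_Mapping.lookup p M) * (\<Prod>\<alpha>\<in>#M. f \<alpha>))"

lemma poly_mapping_single_induct:
  fixes p :: "'a \<Rightarrow>\<^sub>0 'b::comm_monoid_add"
  assumes "\<And>M a. P (Poly_Mapping.single M a)" and "\<And>p q. P p \<Longrightarrow> P q \<Longrightarrow> P (p + q)"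
  shows "P p"
proof (induction p rule: update_induct)
  case const
  show ?case using assms(1)[of undefined 0] by simp
next
  case (update f a b)
  have "Poly_Mapping.update a b f = f + Poly_Mapping.single a b"
    using update by (intro poly_mapping_eqI)
      (auto simp: lookup_update lookup_add lookup_single in_keys_iff when_def)
  then show ?case using assms update by simp
qed

lemma
  assumes add: "\<And>a b. c (a + b) = c a + c b" and mult: "\<And>a b. c (a * b) = c a * c b" and one: "c 1 = 1"
  shows poly_eval_add: "poly_eval c f (p + q) = poly_eval c f p + poly_eval c f q"
    and poly_eval_single: "poly_eval c f (Poly_Mapping.single M a) = c a * (\<Prod>\<alpha>\<in>#M. f \<alpha>)"
    and poly_eval_mult: "poly_eval c f (p * q) = poly_eval c f p * poly_eval c f q"
proof -
  have zero: "c 0 = 0" using add[of 0 0] by simp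
  show a: "poly_eval c f (p + q) = poly_eval c f p + poly_eval c f q" for p q
    unfolding poly_eval_def
    by (rule setsum_keys_plus_distrib) (auto simp: zero add algebra_simps)
  show s: "poly_eval c f (Poly_Mapping.single M a) = c a * (\<Prod>\<alpha>\<in>#M. f \<alpha>)" for M a
    by (cases "a = 0") (auto simp: poly_eval_def zero)
  show "poly_eval c f (p * q) = poly_eval c f p * poly_eval c f q"
  proof (induction p rule: poly_mapping_single_induct)
    case (1 M a)
    show ?case
    proof (induction q rule: poly_mapping_single_induct)
      case (1 N b)
      show ?case by (simp add: mult_single s mult)
    next
      case (2 p q)
      then show ?case by (simp add: a algebra_simps)
    qed
  next
    case (2 p q)
    then show ?case by (simp add: a algebra_simps)
  qed
qed

lemma fock_abs_cases: obtains p where "w = abs_fock p"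
  by (metis Quotient_abs_rep Quotient_fock)

text \<open>The universal property: a linear map from the forms to a commutative algebra extends to a
  homomorphism on the symmetric algebra.\<close>

lemma fock_hom_exists:
  fixes c :: "complex \<Rightarrow> 'r::comm_ring_1" and f :: "kform \<Rightarrow> 'r"
  assumes c: "\<And>a b. c (a + b) = c a + c b" "\<And>a b. c (a * b) = c a * c b" "c 1 = 1"
    and f: "\<And>\<alpha> \<beta>. f (\<alpha> + \<beta>) = f \<alpha> + f \<beta>" "\<And>a \<alpha>. f (scale_form a \<alpha>) = c a * f \<alpha>"
  obtains \<Phi> :: "fock \<Rightarrow> 'r" where "\<And>v w. \<Phi> (v + w) = \<Phi> v + \<Phi> w" "\<And>v w. \<Phi> (v * w) = \<Phi> v * \<Phi> w"
    "\<And>a. \<Phi> (scalar a) = c a" "\<And>\<alpha>. \<Phi> (embed \<alpha>) = f \<alpha>"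
proof -
  let ?e = "poly_eval c f"
  note ev = poly_eval_add[of c, OF c] poly_eval_single[of c, OF c] poly_eval_mult[of c, OF c]
  have const: "?e (poly_const a) = c a" for a
    by (simp add: poly_const_def ev)
  have ind: "?e (indet \<alpha>) = f \<alpha>" for \<alpha>
    by (simp add: indet_def ev c)
  have diff: "?e (p - q) = ?e p - ?e q" for p q
    using ev(1)[of f "p - q" q] by simp
  have "?e p = 0" if "p \<in> sym_ideal" for p
    using that unfolding sym_ideal_def
  proof (rule module.span_induct_alt[OF module_mult])
    show "?e 0 = 0" by (simp add: poly_eval_def)
    show "?e (a * x + y) = 0" if "x \<in> linear_relators" "?e y = 0" for a x y
      using that by (auto simp: linear_relators_def ev diff const ind f)
  qed
  then have rel: "?e p = ?e q" if "sym_rel p q" for p q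
    using that diff[of p q] by (simp add: sym_rel_def)
  define \<Phi> where "\<Phi> = (\<lambda>w. ?e (rep_fock w))"
  have abs: "\<Phi> (abs_fock p) = ?e p" for p
    unfolding \<Phi>_def by (rule rel) (metis Quotient_fock Quotient_rep_abs sym_rel_def diff_self sym_ideal_zero)
  show ?thesis
  proof
    show "\<Phi> (v + w) = \<Phi> v + \<Phi> w" "\<Phi> (v * w) = \<Phi> v * \<Phi> w" for v w
      by (cases v rule: fock_abs_cases; cases w rule: fock_abs_cases;
          simp add: abs ev plus_fock.abs_eq times_fock.abs_eq)+
    show "\<Phi> (scalar a) = c a" "\<Phi> (embed \<alpha>) = f \<alpha>" for a \<alpha>
      by (simp_all add: scalar.abs_eq embed.abs_eq abs const ind)
  qed
qed

lemma scalar_add: "scalar (a + b) = scalar a + scalar b"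
  and scalar_mult: "scalar (a * b) = scalar a * scalar b"
  and scalar_0: "scalar 0 = 0" and scalar_1: "scalar 1 = 1"
  by (transfer; simp add: poly_const_def sym_rel_def single_add mult_single sym_ideal_zero)+

lemma W_on_0: "0 \<in> W_on X" and W_on_1: "1 \<in> W_on X"
  using W_on_scalar[of 0 X] W_on_scalar[of 1 X] by (simp_all add: scalar_0 scalar_1)

lemma W_on_mono: "v \<in> W_on X \<Longrightarrow> Y \<subseteq> X \<Longrightarrow> v \<in> W_on Y"
  by (induction rule: W_on.induct) (auto intro: W_on.intros)

lemma W_on_empty: "W_on {} = UNIV"
proof -
  have "abs_fock p \<in> W_on {}" for p
  proof (induction p rule: poly_mapping_single_induct)
    case (1 M a)
    show ?case
    proof (induction M)
      case empty
      show ?case using W_on_scalar[of a "{}"] by (simp add: scalar.abs_eq poly_const_def)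
    next
      case (add \<alpha> M)
      have "abs_fock (Poly_Mapping.single (add_mset \<alpha> M) a) = embed \<alpha> * abs_fock (Poly_Mapping.single M a)"
        by (simp add: embed.abs_eq indet_def times_fock.abs_eq mult_single)
      then show ?case using W_on_mult[OF W_on_embed add] by simp
    qed
  next
    case (2 p q)
    then show ?case using W_on_add by (metis plus_fock.abs_eq)
  qed
  then show ?thesis by (metis UNIV_eq_I fock_abs_cases)
qed

lemma fock_induct [case_names scalar embed add mult]:
  assumes "\<And>c. P (scalar c)" "\<And>\<alpha>. P (embed \<alpha>)" "\<And>v w. P v \<Longrightarrow> P w \<Longrightarrow> P (v + w)"
    "\<And>v w. P v \<Longrightarrow> P w \<Longrightarrow> P (v * w)"
  shows "P w"
proof -
  have "w \<in> W_on {}" by (simp add: W_on_empty)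
  then show ?thesis by induction (use assms in auto)
qed

text \<open>A linear functional \<open>l\<close> on the forms extends to a derivation \<open>D\<close>: apply the universal property
  to \<open>\<alpha> \<mapsto> \<alpha> + l(\<alpha>) T\<close> with values in the polynomials in \<open>T\<close> over the symmetric algebra. The resulting
  homomorphism has the form \<open>w + D w T + \<dots>\<close>, and its multiplicativity is the product rule for \<open>D\<close>.\<close>

lemma fock_derivation_exists:
  fixes l :: "kform \<Rightarrow> complex"
  assumes "\<And>\<alpha> \<beta>. l (\<alpha> + \<beta>) = l \<alpha> + l \<beta>" "\<And>a \<alpha>. l (scale_form a \<alpha>) = a * l \<alpha>"
  obtains D :: "fock \<Rightarrow> fock" where "\<And>v w. D (v + w) = D v + D w"
    "\<And>v w. D (v * w) = D v * w + v * D w" "\<And>a. D (scalar a) = 0"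
    "\<And>\<alpha>. D (embed \<alpha>) = scalar (l \<alpha>)"
proof -
  let ?c = "\<lambda>a. [:scalar a:]" and ?f = "\<lambda>\<alpha>. [:embed \<alpha>, scalar (l \<alpha>):]"
  have emb: "embed (\<alpha> + \<beta>) = embed \<alpha> + embed \<beta>" for \<alpha> \<beta>
  proof transfer
    fix \<alpha> \<beta>
    have "indet (\<alpha> + \<beta>) - indet \<alpha> - indet \<beta> \<in> sym_ideal"
      unfolding sym_ideal_def by (rule module.span_base[OF module_mult]) (auto simp: linear_relators_def)
    then show "sym_rel (indet (\<alpha> + \<beta>)) (indet \<alpha> + indet \<beta>)"
      by (simp add: sym_rel_def algebra_simps)
  qed
  have esc: "embed (scale_form a \<alpha>) = scalar a * embed \<alpha>" for a \<alpha>
  proof transfer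
    fix a \<alpha>
    show "sym_rel (indet (scale_form a \<alpha>)) (poly_const a * indet \<alpha>)"
      unfolding sym_rel_def sym_ideal_def
      by (rule module.span_base[OF module_mult]) (auto simp: linear_relators_def)
  qed
  obtain \<Phi> :: "fock \<Rightarrow> fock poly" where \<Phi>: "\<And>v w. \<Phi> (v + w) = \<Phi> v + \<Phi> w"
    "\<And>v w. \<Phi> (v * w) = \<Phi> v * \<Phi> w" "\<And>a. \<Phi> (scalar a) = ?c a" "\<And>\<alpha>. \<Phi> (embed \<alpha>) = ?f \<alpha>"
    by (rule fock_hom_exists[of ?c ?f])
       (auto simp: scalar_add scalar_mult scalar_1 assms emb esc one_pCons)
  have c0: "coeff (\<Phi> w) 0 = w" for w
    by (induction w rule: fock_induct) (simp_all add: \<Phi> coeff_mult)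
  show ?thesis
  proof
    show "coeff (\<Phi> (v + w)) 1 = coeff (\<Phi> v) 1 + coeff (\<Phi> w) 1" for v w
      by (simp add: \<Phi>)
    show "coeff (\<Phi> (v * w)) 1 = coeff (\<Phi> v) 1 * w + v * coeff (\<Phi> w) 1" for v w
      using c0 by (simp add: \<Phi> coeff_mult)
    show "coeff (\<Phi> (scalar a)) 1 = 0" for a
      by (simp add: \<Phi>)
    show "coeff (\<Phi> (embed \<alpha>)) 1 = scalar (l \<alpha>)" for \<alpha>
      by (simp add: \<Phi>)
  qed
qed


section \<open>The value of a form at a point\<close>

lemma residue_lincomb:
  assumes "f meromorphic_on UNIV" "g meromorphic_on UNIV"
  shows "residue (\<lambda>s. a * f s + b * g s) t = a * residue f t + b * residue g t"
proof -
  obtain F where F: "(\<lambda>w. f (t + w)) has_laurent_expansion F"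
    using meromorphic_on_imp_has_laurent_expansion[OF assms(1) UNIV_I] by blast
  obtain G where G: "(\<lambda>w. g (t + w)) has_laurent_expansion G"
    using meromorphic_on_imp_has_laurent_expansion[OF assms(2) UNIV_I] by blast
  have "(\<lambda>w. a * f (t + w) + b * g (t + w)) has_laurent_expansion fls_const a * F + fls_const b * G"
    by (intro laurent_expansion_intros F G)
  then have "residue (\<lambda>s. a * f s + b * g s) t = fls_residue (fls_const a * F + fls_const b * G)"
    by (rule has_laurent_expansion_residue)
  then show ?thesis
    using has_laurent_expansion_residue[OF F] has_laurent_expansion_residue[OF G] by simp
qed

lemma coeff_analytic:
  assumes "regular_at \<alpha> (chart k t)"
  shows "form_coeff \<alpha> k analytic_on {t}"
  using assms nicely_meromorphic_on_imp_analytic_at[OF coeff_props(1) UNIV_I]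
  by (auto simp: regular_at_def)

text \<open>The value at \<open>p\<close>, which is linear on the forms regular at \<open>p\<close>, extends to a linear functional on
  all forms: the residue of \<open>\<alpha> / (s - t)\<close> at \<open>p\<close> is the constant coefficient of the Laurent expansion.\<close>

lemma form_value_extends:
  obtains l :: "kform \<Rightarrow> complex" where "\<And>\<alpha> \<beta>. l (\<alpha> + \<beta>) = l \<alpha> + l \<beta>"
    "\<And>a \<alpha>. l (scale_form a \<alpha>) = a * l \<alpha>" "\<And>\<alpha>. regular_at \<alpha> p \<Longrightarrow> l \<alpha> = form_value u \<alpha> p"
proof -
  obtain k t d where ktd: "p = chart k t" "\<And>\<alpha>. form_value u \<alpha> p = form_coeff \<alpha> k t / d"
    by (cases p) (metis chart.simps(1) form_value.simps(1), metis chart.simps(2) form_value.simps(2))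
  let ?f = "\<lambda>\<alpha> s. form_coeff \<alpha> k s / (s - t)"
  have mero: "?f \<alpha> meromorphic_on UNIV" for \<alpha>
    by (intro meromorphic_intros coeff_props)
  have lin: "residue (?f \<gamma>) t = a * residue (?f \<alpha>) t + b * residue (?f \<beta>) t"
    if "\<forall>\<^sub>F s in at t. form_coeff \<gamma> k s = a * form_coeff \<alpha> k s + b * form_coeff \<beta> k s" for a b \<alpha> \<beta> \<gamma>
  proof -
    have "\<forall>\<^sub>F s in at t. ?f \<gamma> s = a * ?f \<alpha> s + b * ?f \<beta> s"
      using that by eventually_elim (simp add: add_divide_distrib)
    then have "residue (?f \<gamma>) t = residue (\<lambda>s. a * ?f \<alpha> s + b * ?f \<beta> s) t"
      by (rule residue_cong) simp
    then show ?thesis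
      by (simp only: residue_lincomb[OF mero mero])
  qed
  show ?thesis
  proof
    show "residue (?f (\<alpha> + \<beta>)) t / d = residue (?f \<alpha>) t / d + residue (?f \<beta>) t / d" for \<alpha> \<beta>
    proof -
      have "residue (?f (\<alpha> + \<beta>)) t = 1 * residue (?f \<alpha>) t + 1 * residue (?f \<beta>) t"
        by (rule lin) (simp only: mult_1_left coeff_plus)
      then show ?thesis by (simp only: mult_1_left add_divide_distrib)
    qed
    show "residue (?f (scale_form a \<alpha>)) t / d = a * (residue (?f \<alpha>) t / d)" for a \<alpha>
    proof -
      have "residue (?f (scale_form a \<alpha>)) t = a * residue (?f \<alpha>) t + 0 * residue (?f \<alpha>) t"
        by (rule lin) (simp only: mult_zero_left add_0_right coeff_scale_form)
      then show ?thesis by (simp only: mult_zero_left add_0_right times_divide_eq_right)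
    qed
    show "residue (?f \<alpha>) t / d = form_value u \<alpha> p" if "regular_at \<alpha> p" for \<alpha>
    proof -
      have "form_coeff \<alpha> k analytic_on {t}"
        using that by (intro coeff_analytic) (simp only: ktd(1))
      then obtain S where "open S" "t \<in> S" "form_coeff \<alpha> k holomorphic_on S"
        unfolding analytic_at by blast
      then have "residue (?f \<alpha>) t = form_coeff \<alpha> k t" by (rule residue_simple)
      then show ?thesis by (simp only: ktd(2))
    qed
  qed
qed


section \<open>The operator \<open>i(z)\<close>\<close>

lemma W_on_regular: "regular_at \<alpha> z \<Longrightarrow> embed \<alpha> \<in> W_on {z}"
  by (auto intro: W_on_embed)

lemma derivation_properties:
  assumes "(\<forall>w. w \<notin> W_on {z} \<longrightarrow> D w = 0) \<and>
     (\<forall>w\<in>W_on {z}. D w \<in> W_on {z}) \<and>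
     linear_on_fock (W_on {z}) D (\<lambda>c w. scalar c * w) \<and>
     (\<forall>v\<in>W_on {z}. \<forall>w\<in>W_on {z}. D (v * w) = D v * w + v * D w) \<and>
     D 1 = 0 \<and>
     (\<forall>\<alpha>. regular_at \<alpha> z \<longrightarrow> D (embed \<alpha>) = scalar (- form_value u \<alpha> z))"
  shows "w \<notin> W_on {z} \<Longrightarrow> D w = 0"
    "v \<in> W_on {z} \<Longrightarrow> w \<in> W_on {z} \<Longrightarrow> D (v + w) = D v + D w"
    "v \<in> W_on {z} \<Longrightarrow> w \<in> W_on {z} \<Longrightarrow> D (v * w) = D v * w + v * D w"
    "D (scalar c) = 0" "regular_at \<alpha> z \<Longrightarrow> D (embed \<alpha>) = scalar (- form_value u \<alpha> z)"
proof -
  have "D (scalar c * 1) = scalar c * D 1" and one: "D 1 = 0"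
    using assms W_on_1[of "{z}"] unfolding linear_on_fock_def by blast+
  then show "D (scalar c) = 0" by simp
qed (use assms in \<open>unfold linear_on_fock_def, blast\<close>)+

lemma i_field_unique_existence:
  "\<exists>!D. (\<forall>w. w \<notin> W_on {z} \<longrightarrow> D w = 0) \<and>
     (\<forall>w\<in>W_on {z}. D w \<in> W_on {z}) \<and>
     linear_on_fock (W_on {z}) D (\<lambda>c w. scalar c * w) \<and>
     (\<forall>v\<in>W_on {z}. \<forall>w\<in>W_on {z}. D (v * w) = D v * w + v * D w) \<and>
     D 1 = 0 \<and>
     (\<forall>\<alpha>. regular_at \<alpha> z \<longrightarrow> D (embed \<alpha>) = scalar (- form_value u \<alpha> z))"
    (is "\<exists>!D. ?P D")
proof (rule ex_ex1I)
  obtain l where l: "\<And>\<alpha> \<beta>. l (\<alpha> + \<beta>) = l \<alpha> + l \<beta>"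
    "\<And>a \<alpha>. l (scale_form a \<alpha>) = a * l \<alpha>" "\<And>\<alpha>. regular_at \<alpha> z \<Longrightarrow> l \<alpha> = form_value u \<alpha> z"
    using form_value_extends[of z u] by metis
  obtain D where D: "\<And>v w. D (v + w) = D v + D w"
    "\<And>v w. D (v * w) = D v * w + v * D w" "\<And>a. D (scalar a) = 0"
    "\<And>\<alpha>. D (embed \<alpha>) = scalar (- l \<alpha>)"
    by (rule fock_derivation_exists[of "\<lambda>\<alpha>. - l \<alpha>"]) (auto simp: l)
  have clos: "D w \<in> W_on {z}" if "w \<in> W_on {z}" for w
    using that by induction (auto simp: D intro: W_on.intros W_on_0)
  have sc: "scalar c * w \<in> W_on {z}" if "w \<in> W_on {z}" for c w
    using that by (intro W_on_mult W_on_scalar)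
  have "D 1 = 0" using D(3)[of 1] by (simp add: scalar_1)
  then have "?P (\<lambda>w. if w \<in> W_on {z} then D w else 0)"
    by (auto simp: linear_on_fock_def D clos sc W_on_add W_on_mult W_on_1 W_on_regular l)
  then show "\<exists>D. ?P D"
    by (rule exI[of ?P "\<lambda>w. if w \<in> W_on {z} then D w else 0"])
next
  fix D D' assume D: "?P D" "?P D'"
  have props: "w \<notin> W_on {z} \<Longrightarrow> E w = 0"
    "v \<in> W_on {z} \<Longrightarrow> w \<in> W_on {z} \<Longrightarrow> E (v + w) = E v + E w"
    "v \<in> W_on {z} \<Longrightarrow> w \<in> W_on {z} \<Longrightarrow> E (v * w) = E v * w + v * E w"
    "E (scalar c) = 0" "regular_at \<alpha> z \<Longrightarrow> E (embed \<alpha>) = scalar (- form_value u \<alpha> z)"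
    if "?P E" for E v w c \<alpha>
    by (fact derivation_properties[OF that])+
  show "D = D'"
  proof
    show "D w = D' w" for w
    proof (cases "w \<in> W_on {z}")
      case True
      then show ?thesis
        by induction (simp_all add: props[OF D(1)] props[OF D(2)])
    next
      case False
      then show ?thesis by (simp add: props(1)[OF D(1)] props(1)[OF D(2)])
    qed
  qed
qed

lemma
  shows i_field_add: "v \<in> W_on {z} \<Longrightarrow> w \<in> W_on {z} \<Longrightarrow> i_field u z (v + w) = i_field u z v + i_field u z w"
    and i_field_mult: "v \<in> W_on {z} \<Longrightarrow> w \<in> W_on {z} \<Longrightarrow>
      i_field u z (v * w) = i_field u z v * w + v * i_field u z w"
    and i_field_scalar: "i_field u z (scalar c) = 0"
    and i_field_embed: "regular_at \<alpha> z \<Longrightarrow> i_field u z (embed \<alpha>) = scalar (- form_value u \<alpha> z)"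
  by (fact derivation_properties[OF theI'[OF i_field_unique_existence[of z u], folded i_field_def]])+

lemma i_field_closed:
  assumes "v \<in> W_on X" "z \<in> X"
  shows "i_field u z v \<in> W_on X"
proof -
  have sub: "w \<in> W_on {z}" if "w \<in> W_on X" for w
    using W_on_mono[OF that] assms(2) by simp
  show ?thesis
    using assms(1)
  proof induction
    case (W_on_embed \<alpha>)
    then show ?case using assms(2) by (simp add: i_field_embed W_on_scalar)
  qed (auto simp: i_field_scalar i_field_add i_field_mult sub W_on_0 intro: W_on_add W_on_mult)
qed


section \<open>Sums of products of forms\<close>

text \<open>Families of elements of the symmetric algebra, indexed by a parameter, that are finite sums of
  products of a scalar from \<open>R\<close> and forms from \<open>A\<close>; the scalars and the forms may depend on the
  parameter.\<close>

inductive_set poly_family :: "('z \<Rightarrow> complex) set \<Rightarrow> ('z \<Rightarrow> kform) set \<Rightarrow> ('z \<Rightarrow> fock) set"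
  for R :: "('z \<Rightarrow> complex) set" and A :: "('z \<Rightarrow> kform) set" where
  poly_family_term: "r \<in> R \<Longrightarrow> set as \<subseteq> A \<Longrightarrow>
     (\<lambda>z. scalar (r z) * (\<Prod>a\<leftarrow>as. embed (a z))) \<in> poly_family R A"
| poly_family_add: "G \<in> poly_family R A \<Longrightarrow> H \<in> poly_family R A \<Longrightarrow> (\<lambda>z. G z + H z) \<in> poly_family R A"

lemma poly_family_mult:
  assumes R: "\<And>r s. r \<in> R \<Longrightarrow> s \<in> R \<Longrightarrow> (\<lambda>z. r z * s z) \<in> R"
    and "G \<in> poly_family R A" "H \<in> poly_family R A"
  shows "(\<lambda>z. G z * H z) \<in> poly_family R A"
  using assms(2)
proof induction
  case (poly_family_term r as)
  show ?case using assms(3)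
  proof induction
    case (poly_family_term s bs)
    then have "(\<lambda>z. scalar (r z * s z) * (\<Prod>a\<leftarrow>as @ bs. embed (a z))) \<in> poly_family R A"
      using \<open>r \<in> R\<close> \<open>set as \<subseteq> A\<close> by (intro poly_family.poly_family_term R) auto
    then show ?case by (simp add: scalar_mult algebra_simps)
  next
    case (poly_family_add G H)
    then show ?case using poly_family.poly_family_add by (simp add: distrib_left)
  qed
next
  case (poly_family_add G H)
  then show ?case using poly_family.poly_family_add by (simp add: distrib_right)
qed

lemma poly_family_scalar: "r \<in> R \<Longrightarrow> (\<lambda>z. scalar (r z)) \<in> poly_family R A"
  using poly_family_term[of r R "[]" A] by simp

lemma poly_family_embed: "(\<lambda>_. 1) \<in> R \<Longrightarrow> a \<in> A \<Longrightarrow> (\<lambda>z. embed (a z)) \<in> poly_family R A"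
  using poly_family_term[of "\<lambda>_. 1" R "[a]" A] by (simp add: scalar_1)

lemma W_on_prod:
  assumes "\<And>j. j \<in> J \<Longrightarrow> w j \<in> W_on X"
  shows "(\<Prod>j\<in>J. w j) \<in> W_on X"
  using assms by (induction J rule: infinite_finite_induct) (auto simp: W_on_1 intro: W_on_mult)

text \<open>\<open>W_on X\<close> is spanned by products of forms regular on \<open>X\<close>, since with a constant parameter the sums of
  products are closed under multiplication.\<close>

lemma W_on_sum_of_products_induct [consumes 1, case_names prod add]:
  assumes "w \<in> W_on X"
    and prod: "\<And>c n \<alpha>. \<forall>j<n. \<forall>p\<in>X. regular_at (\<alpha> j) p \<Longrightarrow> P (scalar c * (\<Prod>j<n::nat. embed (\<alpha> j)))"
    and add: "\<And>v w. v \<in> W_on X \<Longrightarrow> w \<in> W_on X \<Longrightarrow> P v \<Longrightarrow> P w \<Longrightarrow> P (v + w)"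
  shows "P w"
proof -
  let ?A = "(\<lambda>\<alpha> (_::unit). \<alpha>) ` {\<alpha>. \<forall>p\<in>X. regular_at \<alpha> p}"
  have "(\<lambda>_. w) \<in> poly_family UNIV ?A"
    using assms(1)
  proof induction
    case (W_on_scalar c)
    show ?case using poly_family_scalar[of "\<lambda>_. c" UNIV ?A] by simp
  next
    case (W_on_embed \<alpha>)
    then show ?case by (intro poly_family_embed[of _ "\<lambda>_. \<alpha>"]) auto
  qed (auto intro: poly_family_add poly_family_mult)
  then have "w \<in> W_on X \<and> P w"
  proof (induction "\<lambda>_::unit. w" arbitrary: w)
    case (poly_family_term r as)
    define \<alpha> where "\<alpha> = (\<lambda>j. (as ! j) ())"
    have reg: "\<forall>j<length as. \<forall>p\<in>X. regular_at (\<alpha> j) p"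
      using poly_family_term(2) nth_mem unfolding \<alpha>_def by fastforce
    have "(\<Prod>a\<leftarrow>as. embed (a ())) = (\<Prod>j<length as. embed (\<alpha> j))"
      by (simp add: \<alpha>_def prod.list_conv_set_nth atLeast0LessThan)
    then have "w = scalar (r ()) * (\<Prod>j<length as. embed (\<alpha> j))"
      using poly_family_term(3) by metis
    then show ?case
      using reg by (auto intro!: prod W_on_mult W_on_scalar W_on_prod W_on_embed)
  next
    case (poly_family_add G H)
    have "w = G () + H ()" using poly_family_add(5) by metis
    then show ?case
      using poly_family_add(2)[of "G ()"] poly_family_add(4)[of "H ()"] add W_on_add by simp
  qed
  then show ?thesis by simp
qed


section \<open>Polydifferentials\<close>

lemma derivation_prod:
  fixes D :: "fock \<Rightarrow> fock"
  assumes "\<And>v w. D (v * w) = D v * w + v * D w" "D 1 = 0" "finite A"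
  shows "D (\<Prod>j\<in>A. f j) = (\<Sum>j\<in>A. D (f j) * (\<Prod>i\<in>A - {j}. f i))"
  using assms(3)
proof induction
  case empty
  show ?case by (simp add: assms)
next
  case (insert x A)
  have "f x * (D (f j) * (\<Prod>i\<in>A - {j}. f i)) = D (f j) * (\<Prod>i\<in>insert x A - {j}. f i)" if "j \<in> A" for j
  proof -
    have "insert x A - {j} = insert x (A - {j})" using insert that by auto
    then show ?thesis using insert by simp
  qed
  moreover have "insert x A - {x} = A" using insert by auto
  ultimately show ?case
    using insert by (simp add: assms sum_distrib_left)
qed

text \<open>The functional for \<open>m\<close> points applies the derivations that extend the values at the points, one
  after the other, and then takes the constant term. The inductive step is the Laplace expansion of a
  permanent.\<close>

lemma iterated_derivation_functional_exists:
  fixes l :: "nat \<Rightarrow> kform \<Rightarrow> complex"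
  assumes l: "\<And>i \<alpha> \<beta>. l i (\<alpha> + \<beta>) = l i \<alpha> + l i \<beta>" "\<And>i a \<alpha>. l i (scale_form a \<alpha>) = a * l i \<alpha>"
  shows "\<exists>L. (\<forall>v w. L (v + w) = L v + L w) \<and> (\<forall>c w. L (scalar c * w) = c * L w) \<and>
    (\<forall>(A :: nat set) \<alpha>. finite A \<longrightarrow> card A \<noteq> m \<longrightarrow> L (\<Prod>j\<in>A. embed (\<alpha> j)) = 0) \<and>
    (\<forall>\<alpha>. L (\<Prod>j<m::nat. embed (\<alpha> j)) = (\<Sum>\<sigma> | \<sigma> permutes {..<m}. \<Prod>i<m. l i (\<alpha> (\<sigma> i))))"
proof (induction m)
  case 0
  obtain \<epsilon> :: "fock \<Rightarrow> complex" where e: "\<And>v w. \<epsilon> (v + w) = \<epsilon> v + \<epsilon> w" "\<And>v w. \<epsilon> (v * w) = \<epsilon> v * \<epsilon> w"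
    "\<And>a. \<epsilon> (scalar a) = a" "\<And>\<alpha>. \<epsilon> (embed \<alpha>) = 0"
    by (rule fock_hom_exists[of "\<lambda>a. a" "\<lambda>_. 0"]) auto
  have e1: "\<epsilon> 1 = 1" using e(3)[of 1] by (simp add: scalar_1)
  have "\<epsilon> (\<Prod>j\<in>A. embed (\<alpha> j)) = (\<Prod>j\<in>A. 0)" if "finite A" for A :: "nat set" and \<alpha>
    using that by induction (simp_all add: e e1)
  then have "\<epsilon> (\<Prod>j\<in>A. embed (\<alpha> j)) = 0" if "finite A" "card A \<noteq> 0" for A :: "nat set" and \<alpha>
    using that by (metis power_0_left prod_constant)
  then show ?case using e e1 by (intro exI[of _ \<epsilon>]) auto
next
  case (Suc m)
  then obtain L where "(\<forall>v w. L (v + w) = L v + L w) \<and> (\<forall>c w. L (scalar c * w) = c * L w) \<and>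
    (\<forall>(A :: nat set) \<alpha>. finite A \<longrightarrow> card A \<noteq> m \<longrightarrow> L (\<Prod>j\<in>A. embed (\<alpha> j)) = 0) \<and>
    (\<forall>\<alpha>. L (\<Prod>j<m. embed (\<alpha> j)) = (\<Sum>\<sigma> | \<sigma> permutes {..<m}. \<Prod>i<m. l i (\<alpha> (\<sigma> i))))"
    by (elim exE)
  then have L: "\<And>v w. L (v + w) = L v + L w" "\<And>c w. L (scalar c * w) = c * L w"
    "\<And>(A :: nat set) \<alpha>. finite A \<Longrightarrow> card A \<noteq> m \<Longrightarrow> L (\<Prod>j\<in>A. embed (\<alpha> j)) = 0"
    "\<And>\<alpha>. L (\<Prod>j<m. embed (\<alpha> j)) = (\<Sum>\<sigma> | \<sigma> permutes {..<m}. \<Prod>i<m. l i (\<alpha> (\<sigma> i)))"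
    by blast+
  obtain D :: "fock \<Rightarrow> fock" where D: "\<And>v w. D (v + w) = D v + D w"
    "\<And>v w. D (v * w) = D v * w + v * D w" "\<And>a. D (scalar a) = 0"
    "\<And>\<alpha>. D (embed \<alpha>) = scalar (l m \<alpha>)"
    using fock_derivation_exists[of "l m"] l by metis
  have D1: "D 1 = 0" using D(3)[of 1] by (simp add: scalar_1)
  have L0: "L 0 = 0" using L(1)[of 0 0] by simp
  have Lsum: "L (\<Sum>j\<in>A. f j) = (\<Sum>j\<in>A. L (f j))" for A :: "nat set" and f
    by (induction A rule: infinite_finite_induct) (simp_all add: L L0)
  have LD: "L (D (\<Prod>j\<in>A. embed (\<alpha> j))) = (\<Sum>j\<in>A. l m (\<alpha> j) * L (\<Prod>i\<in>A - {j}. embed (\<alpha> i)))"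
    if "finite A" for A :: "nat set" and \<alpha>
    by (simp add: derivation_prod[of D, OF D(2) D1 that] Lsum D L)
  have "L (D (\<Prod>j\<in>A. embed (\<alpha> j))) = 0" if "finite A" "card A \<noteq> Suc m" for A :: "nat set" and \<alpha>
  proof -
    have "card (A - {j}) \<noteq> m" if "j \<in> A" for j
      using that \<open>finite A\<close> \<open>card A \<noteq> Suc m\<close> by (metis card_Suc_Diff1)
    then show ?thesis using that by (auto simp: LD L intro!: sum.neutral)
  qed
  moreover have "L (D (\<Prod>j<Suc m. embed (\<alpha> j))) =
     (\<Sum>\<sigma> | \<sigma> permutes {..<Suc m}. \<Prod>i<Suc m. l i (\<alpha> (\<sigma> i)))" for \<alpha>
  proof -
    \<comment> \<open>A permutation of \<open>{..m}\<close> sending \<open>m\<close> to \<open>b\<close> is the transposition of \<open>m\<close> and \<open>b\<close> after a permutation of \<open>{..<m}\<close>.\<close>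
    have "(\<Sum>\<sigma> | \<sigma> permutes {..<Suc m}. \<Prod>i<Suc m. l i (\<alpha> (\<sigma> i))) =
      (\<Sum>b\<in>insert m {..<m}. \<Sum>\<sigma> | \<sigma> permutes {..<m}. \<Prod>i<Suc m. l i (\<alpha> ((Transposition.transpose m b \<circ> \<sigma>) i)))"
      unfolding lessThan_Suc by (rule sum_over_permutations_insert) auto
    also have "\<dots> = (\<Sum>b<Suc m. l m (\<alpha> b) * L (\<Prod>i\<in>{..<Suc m} - {b}. embed (\<alpha> i)))"
      unfolding lessThan_Suc[symmetric]
    proof (rule sum.cong[OF refl])
      fix b assume b: "b \<in> {..<Suc m}"
      have "(\<Sum>\<sigma> | \<sigma> permutes {..<m}. \<Prod>i<Suc m. l i (\<alpha> ((Transposition.transpose m b \<circ> \<sigma>) i))) =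
        (\<Sum>\<sigma> | \<sigma> permutes {..<m}. l m (\<alpha> b) * (\<Prod>i<m. l i ((\<alpha> \<circ> Transposition.transpose m b) (\<sigma> i))))"
      proof (intro sum.cong refl)
        fix \<sigma> assume "\<sigma> \<in> {\<sigma>. \<sigma> permutes {..<m}}"
        then have "\<sigma> m = m" using permutes_not_in[of \<sigma> "{..<m}" m] by simp
        then show "(\<Prod>i<Suc m. l i (\<alpha> ((Transposition.transpose m b \<circ> \<sigma>) i))) =
          l m (\<alpha> b) * (\<Prod>i<m. l i ((\<alpha> \<circ> Transposition.transpose m b) (\<sigma> i)))"
          by (simp add: mult.commute)
      qed
      also have "\<dots> = l m (\<alpha> b) * L (\<Prod>i<m. embed ((\<alpha> \<circ> Transposition.transpose m b) i))"
        by (simp only: L(4) sum_distrib_left)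
      also have "(\<Prod>i<m. embed ((\<alpha> \<circ> Transposition.transpose m b) i)) = (\<Prod>i\<in>{..<Suc m} - {b}. embed (\<alpha> i))"
      proof (rule prod.reindex_bij_witness[of _ "Transposition.transpose m b" "Transposition.transpose m b"])
      qed (use b in \<open>auto simp: Transposition.transpose_def split: if_splits\<close>)
      finally show "(\<Sum>\<sigma> | \<sigma> permutes {..<m}. \<Prod>i<Suc m. l i (\<alpha> ((Transposition.transpose m b \<circ> \<sigma>) i))) =
        l m (\<alpha> b) * L (\<Prod>i\<in>{..<Suc m} - {b}. embed (\<alpha> i))" .
    qed
    finally show ?thesis by (simp only: LD[OF finite_lessThan])
  qed
  ultimately show ?case
    by (intro exI[of _ "\<lambda>w. L (D w)"]) (simp add: D L)
qed

lemma polydiff_unique_existence: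
  fixes m :: nat
  assumes X: "X = x ` {..<m}"
  shows "\<exists>!L. (\<forall>w. w \<notin> W_on X \<longrightarrow> L w = 0) \<and>
     linear_on_fock (W_on X) L (*) \<and>
     (\<forall>n \<alpha>. (\<forall>j<n. \<forall>p\<in>X. regular_at (\<alpha> j) p) \<longrightarrow>
        L (\<Prod>j<n. embed (\<alpha> j)) =
          (if n = m then \<Sum>\<sigma> | \<sigma> permutes {..<m}. \<Prod>i<m. form_value u (\<alpha> (\<sigma> i)) (x i) else 0))"
    (is "\<exists>!L. ?P L")
proof (rule ex_ex1I)
  let ?Q = "\<lambda>p l. (\<forall>\<alpha> \<beta>. l (\<alpha> + \<beta>) = l \<alpha> + l \<beta>) \<and> (\<forall>a \<alpha>. l (scale_form a \<alpha>) = a * l \<alpha>) \<and>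
    (\<forall>\<alpha>. regular_at \<alpha> p \<longrightarrow> l \<alpha> = form_value u \<alpha> p)"
  have "\<forall>p. \<exists>l. ?Q p l"
  proof
    show "\<exists>l. ?Q p l" for p
      by (rule form_value_extends[of p u]) blast
  qed
  then obtain l where "\<forall>p. ?Q p (l p)"
    by (rule choice[THEN exE])
  then have l: "\<And>p \<alpha> \<beta>. l p (\<alpha> + \<beta>) = l p \<alpha> + l p \<beta>"
    "\<And>p a \<alpha>. l p (scale_form a \<alpha>) = a * l p \<alpha>" "\<And>p \<alpha>. regular_at \<alpha> p \<Longrightarrow> l p \<alpha> = form_value u \<alpha> p"
    by blast+
  obtain L where "(\<forall>v w. L (v + w) = L v + L w) \<and> (\<forall>c w. L (scalar c * w) = c * L w) \<and>
    (\<forall>(A :: nat set) \<alpha>. finite A \<longrightarrow> card A \<noteq> m \<longrightarrow> L (\<Prod>j\<in>A. embed (\<alpha> j)) = 0) \<and>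
    (\<forall>\<alpha>. L (\<Prod>j<m. embed (\<alpha> j)) = (\<Sum>\<sigma> | \<sigma> permutes {..<m}. \<Prod>i<m. l (x i) (\<alpha> (\<sigma> i))))"
    using iterated_derivation_functional_exists[of "\<lambda>i. l (x i)" m, OF l(1) l(2)] by (elim exE)
  then have L: "\<And>v w. L (v + w) = L v + L w" "\<And>c w. L (scalar c * w) = c * L w"
    "\<And>n \<alpha>. n \<noteq> m \<Longrightarrow> L (\<Prod>j<n. embed (\<alpha> j)) = 0"
    "\<And>\<alpha>. L (\<Prod>j<m. embed (\<alpha> j)) = (\<Sum>\<sigma> | \<sigma> permutes {..<m}. \<Prod>i<m. l (x i) (\<alpha> (\<sigma> i)))"
    by simp_all
  have val: "(\<Prod>i<m. l (x i) (\<alpha> (\<sigma> i))) = (\<Prod>i<m. form_value u (\<alpha> (\<sigma> i)) (x i))"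
    if "\<sigma> permutes {..<m}" "\<forall>j<m. \<forall>p\<in>X. regular_at (\<alpha> j) p" for \<alpha> \<sigma>
  proof (intro prod.cong refl l)
    fix i assume "i \<in> {..<m}"
    then have "\<sigma> i < m" "x i \<in> X" using permutes_in_image[OF that(1), of i] X by auto
    then show "regular_at (\<alpha> (\<sigma> i)) (x i)" using that by auto
  qed
  have mem: "(\<Prod>j<n. embed (\<alpha> j)) \<in> W_on X" if "\<forall>j<n. \<forall>p\<in>X. regular_at (\<alpha> j) p" for n :: nat and \<alpha>
    using that by (intro W_on_prod W_on_embed) auto
  have "linear_on_fock (W_on X) (\<lambda>w. if w \<in> W_on X then L w else 0) (*)"
    unfolding linear_on_fock_def
    by (simp add: L W_on_add W_on_mult W_on_scalar)
  moreover have "L (\<Prod>j<m. embed (\<alpha> j)) = (\<Sum>\<sigma> | \<sigma> permutes {..<m}. \<Prod>i<m. form_value u (\<alpha> (\<sigma> i)) (x i))"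
    if "\<forall>j<m. \<forall>p\<in>X. regular_at (\<alpha> j) p" for \<alpha>
    unfolding L(4) by (rule sum.cong[OF refl]) (use val that in simp)
  ultimately have "?P (\<lambda>w. if w \<in> W_on X then L w else 0)"
    by (simp add: mem L(3))
  then show "\<exists>L. ?P L"
    by (rule exI[of ?P "\<lambda>w. if w \<in> W_on X then L w else 0"])
next
  fix L L' assume L: "?P L" "?P L'"
  note off = L(1)[THEN conjunct1] L(2)[THEN conjunct1]
    and lin = L(1)[THEN conjunct2, THEN conjunct1] L(2)[THEN conjunct2, THEN conjunct1]
    and val = L(1)[THEN conjunct2, THEN conjunct2] L(2)[THEN conjunct2, THEN conjunct2]
  have "L w = L' w" if "w \<in> W_on X" for w
    using that
  proof (induction rule: W_on_sum_of_products_induct)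
    case (prod c n \<alpha>)
    then have "(\<Prod>j<n. embed (\<alpha> j)) \<in> W_on X"
      by (intro W_on_prod W_on_embed) auto
    then show ?case using lin val prod unfolding linear_on_fock_def by simp
  next
    case (add v w)
    then show ?case using lin unfolding linear_on_fock_def by simp
  qed
  then have "L w = L' w" for w
    by (cases "w \<in> W_on X") (simp_all add: off)
  then show "L = L'" by (intro ext)
qed

lemma
  fixes m :: nat
  assumes "X = x ` {..<m}"
  shows polydiff_add: "v \<in> W_on X \<Longrightarrow> w \<in> W_on X \<Longrightarrow> polydiff u m x (v + w) = polydiff u m x v + polydiff u m x w"
    and polydiff_scalar: "w \<in> W_on X \<Longrightarrow> polydiff u m x (scalar c * w) = c * polydiff u m x w"
    and polydiff_prod: "(\<And>j p. j < n \<Longrightarrow> p \<in> X \<Longrightarrow> regular_at (\<alpha> j) p) \<Longrightarrow> polydiff u m x (\<Prod>j<n. embed (\<alpha> j)) =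
      (if n = m then \<Sum>\<sigma> | \<sigma> permutes {..<m}. \<Prod>i<m. form_value u (\<alpha> (\<sigma> i)) (x i) else 0)"
proof -
  let ?L = "polydiff u m x"
  note * = theI'[OF polydiff_unique_existence[of X x m u, OF assms],
      folded polydiff_def[of u m x, unfolded Let_def assms[symmetric]]]
  note lin = *[THEN conjunct2, THEN conjunct1, unfolded linear_on_fock_def]
  show "v \<in> W_on X \<Longrightarrow> w \<in> W_on X \<Longrightarrow> ?L (v + w) = ?L v + ?L w" "w \<in> W_on X \<Longrightarrow> ?L (scalar c * w) = c * ?L w"
    using lin by blast+
  show "(\<And>j p. j < n \<Longrightarrow> p \<in> X \<Longrightarrow> regular_at (\<alpha> j) p) \<Longrightarrow> ?L (\<Prod>j<n. embed (\<alpha> j)) =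
      (if n = m then \<Sum>\<sigma> | \<sigma> permutes {..<m}. \<Prod>i<m. form_value u (\<alpha> (\<sigma> i)) (x i) else 0)"
    by (rule *[THEN conjunct2, THEN conjunct2, THEN spec[of _ n], THEN spec[of _ \<alpha>], THEN mp]) simp
qed


section \<open>Charts of the projective line\<close>

text \<open>The other one of the two charts.\<close>

fun flip :: "chart_index \<Rightarrow> chart_index" where
  "flip Std = AtInf"
| "flip AtInf = Std"

lemma flip_flip [simp]: "flip (flip k) = k"
  by (cases k) auto

lemma chart_flip: "s \<noteq> 0 \<Longrightarrow> chart (flip k) s = chart k (1 / s)"
  by (cases k) auto

lemma chart_inject [simp]: "chart k s = chart k t \<longleftrightarrow> s = t"
  by (cases k) auto

lemma chart_flip_0_neq [simp]: "chart (flip k) 0 \<noteq> chart k t" "chart k t \<noteq> chart (flip k) 0"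
  by (cases k; auto)+

lemma chart_cases:
  obtains t where "p = chart k t" | "p = chart (flip k) 0"
proof (cases k; cases p)
  fix t assume "k = AtInf" "p = Aff t"
  then show ?thesis using that(1)[of "1 / t"] that(2) by (cases "t = 0") auto
qed (use that(1)[of 0] that in auto)

lemma chart_eq_cases:
  assumes "chart k s = chart k' t"
  shows "k' = k \<and> s = t \<or> k' = flip k \<and> t \<noteq> 0 \<and> s = 1 / t"
  using assms by (cases k; cases k') (auto split: if_splits)

lemma is_pole_inverse_mult:
  fixes f g h :: "complex \<Rightarrow> complex"
  assumes "t \<noteq> 0" "h \<midarrow>t\<rightarrow> c" "c \<noteq> 0" "is_pole g (1 / t)"
    "\<And>s. s \<noteq> 0 \<Longrightarrow> f s = h s * g (1 / s)"
  shows "is_pole f t"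
proof -
  have "filterlim g at_infinity (filtermap (\<lambda>s. 1 / s) (at t))"
    using assms(4) unfolding filtermap_inverse_at[OF assms(1)] is_pole_def .
  then have "filterlim (\<lambda>s. g (1 / s)) at_infinity (at t)"
    by (simp add: filterlim_filtermap)
  then have "filterlim (\<lambda>s. h s * g (1 / s)) at_infinity (at t)"
    by (rule tendsto_mult_filterlim_at_infinity[OF assms(2,3)])
  moreover have "\<forall>\<^sub>F s in at t. h s * g (1 / s) = f s"
    using eventually_neq_at_within[of 0 t UNIV] by eventually_elim (simp add: assms(5))
  ultimately show ?thesis
    unfolding is_pole_def using filterlim_cong[OF refl refl] by fastforce
qed

lemma has_pole_at_chart: "has_pole_at u (chart k t) \<longleftrightarrow> is_pole (\<lambda>s. u (chart k s)) t"
proof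
  assume "has_pole_at u (chart k t)"
  then obtain k' t' where *: "chart k t = chart k' t'" "is_pole (\<lambda>s. u (chart k' s)) t'"
    unfolding has_pole_at_def by metis
  from chart_eq_cases[OF *(1)] show "is_pole (\<lambda>s. u (chart k s)) t"
  proof
    assume "k' = k \<and> t = t'" then show ?thesis using * by simp
  next
    assume k: "k' = flip k \<and> t' \<noteq> 0 \<and> t = 1 / t'"
    show ?thesis
      by (rule is_pole_inverse_mult[of t "\<lambda>_. 1" 1 "\<lambda>s. u (chart k' s)"])
        (use * k in \<open>auto simp: chart_flip\<close>)
  qed
qed (auto simp: has_pole_at_def)

lemma form_coeff_flip:
  "t \<noteq> 0 \<Longrightarrow> form_coeff \<alpha> k t = - (1 / t ^ 2) * form_coeff \<alpha> (flip k) (1 / t)"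
  using coeff_props(3)[of t \<alpha>] coeff_props(3)[of "1 / t" \<alpha>]
  by (cases k) (auto simp: field_simps)

lemma regular_at_chart: "regular_at \<alpha> (chart k t) \<longleftrightarrow> \<not> is_pole (form_coeff \<alpha> k) t"
proof
  assume *: "\<not> is_pole (form_coeff \<alpha> k) t"
  show "regular_at \<alpha> (chart k t)"
    unfolding regular_at_def
  proof (intro allI impI notI)
    fix k' t' assume c: "chart k' t' = chart k t" and p: "is_pole (form_coeff \<alpha> k') t'"
    from chart_eq_cases[OF c[symmetric]] show False
    proof
      assume "k' = k \<and> t = t'" then show ?thesis using * p by simp
    next
      assume k: "k' = flip k \<and> t' \<noteq> 0 \<and> t = 1 / t'"
      have lim: "(\<lambda>s. - (1 / s ^ 2)) \<midarrow>t\<rightarrow> - (1 / t ^ 2)"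
        using k by (intro tendsto_intros) auto
      have "is_pole (form_coeff \<alpha> k) t"
        by (rule is_pole_inverse_mult[OF _ lim, of "form_coeff \<alpha> k'"]) (use p k form_coeff_flip[of _ \<alpha> k] in auto)
      then show False using * by simp
    qed
  qed
qed (auto simp: regular_at_def)


section \<open>Forms are rational\<close>

lemma eventually_not_in_finite: "finite S \<Longrightarrow> \<forall>\<^sub>F y in at (x :: complex). y \<notin> S"
  using islimpt_finite islimpt_iff_eventually by blast

lemma nicely_meromorphic_mult_power_tendsto:
  assumes "f nicely_meromorphic_on UNIV"
  obtains n c where "(\<lambda>t. (t - p) ^ n * f t) \<midarrow>p\<rightarrow> c"
proof (cases "is_pole f p")
  case True
  have "isolated_singularity_at f p"
    using assms by (auto simp: nicely_meromorphic_on_def intro: meromorphic_on_isolated_singularity meromorphic_on_subset)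
  then obtain S where S: "open S" "p \<in> S" "f holomorphic_on S - {p}"
    using analytic_imp_holomorphic isolated_singularity_at_iff_analytic_nhd by auto
  define n g where "n = nat (- zorder f p)" and "g = zor_poly f p"
  obtain r where r: "r > 0" "g holomorphic_on cball p r"
    "\<forall>w\<in>cball p r - {p}. f w = g w / (w - p) ^ n \<and> g w \<noteq> 0"
    using zorder_exist_pole[OF S(3,1,2) True] unfolding n_def g_def by blast
  have "g \<midarrow>p\<rightarrow> g p"
    using r by (metis ball_subset_cball centre_in_ball continuous_on_eq_continuous_at continuous_within
        holomorphic_on_imp_continuous_on holomorphic_on_subset open_ball)
  moreover have "\<forall>\<^sub>F t in at p. (t - p) ^ n * f t = g t"
    unfolding eventually_at using r by (intro exI[of _ r]) (auto simp: dist_commute)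
  ultimately have "(\<lambda>t. (t - p) ^ n * f t) \<midarrow>p\<rightarrow> g p"
    by (simp add: tendsto_cong)
  then show ?thesis by (rule that)
next
  case False
  then have "f analytic_on {p}"
    using assms nicely_meromorphic_on_imp_analytic_at by blast
  then have "f \<midarrow>p\<rightarrow> f p"
    using analytic_at_imp_isCont isCont_def by blast
  then show ?thesis using that[of 0] by simp
qed

text \<open>A function with finitely many poles in the plane and at most a pole at infinity becomes a polynomial
  after multiplication by \<open>\<Prod>\<^sub>p (t - p)\<^bsup>N p\<^esup>\<close>. The bound on the degree will identify coordinates as Moebius
  functions.\<close>

lemma rational_of_meromorphic_on_sphere:
  fixes f :: "complex \<Rightarrow> complex"
  assumes S: "finite S" and an: "\<And>t. t \<notin> S \<Longrightarrow> f analytic_on {t}"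
    and pole: "\<And>p. p \<in> S \<Longrightarrow> \<exists>c. (\<lambda>t. (t - p) ^ N p * f t) \<midarrow>p\<rightarrow> c"
    and inf: "(\<lambda>w. w ^ n * f (1 / w)) \<midarrow>0\<rightarrow> c"
  obtains P where "degree P \<le> n + sum N S" "\<And>t. t \<notin> S \<Longrightarrow> f t * (\<Prod>p\<in>S. (t - p) ^ N p) = poly P t"
proof -
  define q where "q = (\<lambda>t. \<Prod>p\<in>S. (t - p) ^ N p)"
  define g where "g = remove_sings (\<lambda>t. f t * q t)"
  have q: "q analytic_on A" for A
    unfolding q_def by (intro analytic_intros)
  have an': "(\<lambda>t. f t * q t) analytic_on {t}" if "t \<notin> S" for t
    by (intro analytic_intros an q that)
  have eq: "g t = f t * q t" if "t \<notin> S" for t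
    unfolding g_def by (rule remove_sings_at_analytic[OF an'[OF that]])
  have "g analytic_on {t}" for t
  proof (cases "t \<in> S")
    case False
    show ?thesis unfolding g_def by (rule remove_sings_analytic_on[OF an'[OF False]])
  next
    case True
    obtain c where "(\<lambda>x. (x - t) ^ N t * f x) \<midarrow>t\<rightarrow> c" using pole[OF True] by blast
    then have "(\<lambda>x. (x - t) ^ N t * f x * (\<Prod>p\<in>S - {t}. (x - p) ^ N p)) \<midarrow>t\<rightarrow> c * (\<Prod>p\<in>S - {t}. (t - p) ^ N p)"
      by (intro tendsto_intros)
    also have "(\<lambda>x. (x - t) ^ N t * f x * (\<Prod>p\<in>S - {t}. (x - p) ^ N p)) = (\<lambda>x. f x * q x)"
      by (rule ext) (simp add: q_def prod.remove[OF S True] algebra_simps)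
    finally have lim: "(\<lambda>x. f x * q x) \<midarrow>t\<rightarrow> c * (\<Prod>p\<in>S - {t}. (t - p) ^ N p)" .
    have "\<forall>\<^sub>F x in at t. x \<notin> S" by (rule eventually_not_in_finite[OF S])
    then have "\<forall>\<^sub>F x in at t. (\<lambda>t. f t * q t) analytic_on {x}"
      by eventually_elim (rule an')
    then obtain r where r: "r > 0" "\<And>x. x \<noteq> t \<Longrightarrow> dist x t < r \<Longrightarrow> (\<lambda>t. f t * q t) analytic_on {x}"
      unfolding eventually_at by blast
    have "(\<lambda>t. f t * q t) analytic_on ball t r - {t}"
      by (subst analytic_on_analytic_at) (auto simp: dist_commute intro: r)
    then have "isolated_singularity_at (\<lambda>t. f t * q t) t"
      unfolding isolated_singularity_at_def using r(1) by blast
    then show ?thesis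
      unfolding g_def by (rule remove_sings_analytic_at[OF _ lim])
  qed
  then have "g analytic_on UNIV" by (subst analytic_on_analytic_at) blast
  then have hol: "g holomorphic_on UNIV" by (rule analytic_imp_holomorphic)
  define d where "d = n + sum N S"
  have "(\<lambda>w. w ^ n * f (1 / w) * (\<Prod>p\<in>S. (1 - p * w) ^ N p)) \<midarrow>0\<rightarrow> c * (\<Prod>p\<in>S. (1 - p * 0) ^ N p)"
    by (intro tendsto_intros inf)
  moreover have "\<forall>\<^sub>F w in at 0. w ^ n * f (1 / w) * (\<Prod>p\<in>S. (1 - p * w) ^ N p) = w ^ d * g (1 / w)"
  proof -
    have "\<forall>\<^sub>F w in at 0. w \<notin> inverse ` S" by (intro eventually_not_in_finite finite_imageI S)
    moreover have "\<forall>\<^sub>F w in at (0::complex). w \<noteq> 0" by (simp add: eventually_at_filter)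
    ultimately show ?thesis
    proof eventually_elim
      case (elim w)
      then have "1 / w \<notin> S" by (metis image_eqI inverse_eq_divide inverse_inverse_eq)
      moreover have "w ^ sum N S * q (1 / w) = (\<Prod>p\<in>S. (1 - p * w) ^ N p)"
        unfolding q_def power_sum prod.distrib[symmetric] power_mult_distrib[symmetric]
        using elim(2) by (intro prod.cong refl) (simp add: right_diff_distrib mult.commute)
      ultimately show ?case
        by (simp add: eq d_def power_add algebra_simps)
    qed
  qed
  ultimately have lim: "(\<lambda>w. w ^ d * g (1 / w)) \<midarrow>0\<rightarrow> c"
    by (simp add: tendsto_cong)
  then have "\<forall>\<^sub>F w in at 0. norm (w ^ d * g (1 / w)) < norm c + 1"
    by (intro order_tendstoD(2)[OF tendsto_norm]) auto
  then obtain r where r: "r > 0" "\<And>w. w \<noteq> 0 \<Longrightarrow> norm w < r \<Longrightarrow> norm (w ^ d * g (1 / w)) < norm c + 1"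
    unfolding eventually_at by (auto simp: dist_norm)
  have "norm (g t) \<le> (norm c + 1) * norm t ^ d" if "2 / r \<le> norm t" for t
  proof -
    have t: "t \<noteq> 0" using that r by auto
    have "norm (1 / t) \<le> r / 2"
      using that r t by (auto simp: norm_divide field_simps)
    then have "norm (1 / t) < r" using r by simp
    then have "norm ((1 / t) ^ d * g (1 / (1 / t))) < norm c + 1"
      using t by (intro r) auto
    then show ?thesis
      using t by (auto simp: norm_mult norm_divide norm_power field_simps)
  qed
  then have poly: "g \<xi> = (\<Sum>k\<le>d. (deriv ^^ k) g 0 / fact k * \<xi> ^ k)" for \<xi>
    by (rule Liouville_polynomial[OF hol])
  show ?thesis
  proof
    let ?P = "\<Sum>k\<le>d. monom ((deriv ^^ k) g 0 / fact k) k"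
    show "degree ?P \<le> n + sum N S"
      unfolding d_def[symmetric]
      by (rule degree_sum_le) (auto intro: order_trans[OF degree_monom_le])
    show "f t * (\<Prod>p\<in>S. (t - p) ^ N p) = poly ?P t" if "t \<notin> S" for t
      using eq[OF that] poly[of t] by (simp add: q_def poly_sum poly_monom)
  qed
qed

lemma form_coeff_rational:
  obtains S P Q where "finite S" "Q \<noteq> 0"
    "\<And>t. t \<notin> S \<Longrightarrow> \<not> is_pole (form_coeff \<alpha> k) t \<and> poly Q t \<noteq> 0 \<and> form_coeff \<alpha> k t = poly P t / poly Q t"
proof -
  let ?f = "form_coeff \<alpha> k" and ?f' = "form_coeff \<alpha> (flip k)"
  \<comment> \<open>The poles are bounded because the other chart shows that there are none near infinity.\<close>
  define S where "S = {t. is_pole ?f t}"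
  have "\<forall>\<^sub>F w in at 0. ?f' analytic_on {w}"
    using coeff_props(2) by (metis UNIV_I eventually_cosparse_imp_eventually_at
        meromorphic_on_imp_analytic_cosparse)
  then obtain r where r: "r > 0" "\<And>w. w \<noteq> 0 \<Longrightarrow> norm w < r \<Longrightarrow> ?f' analytic_on {w}"
    unfolding eventually_at by (auto simp: dist_norm)
  have "S \<subseteq> cball 0 (1 / r)"
  proof
    fix t assume "t \<in> S"
    show "t \<in> cball 0 (1 / r)"
    proof (rule ccontr)
      assume "t \<notin> cball 0 (1 / r)"
      then have n: "norm t > 1 / r" by simp
      then have t: "t \<noteq> 0" using r(1) by auto
      have "norm (1 / t) < r" using n r(1) t by (simp add: norm_divide field_simps)
      then have "\<not> is_pole ?f' (1 / t)" using r(2)[of "1 / t"] t analytic_at_imp_no_pole by simp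
      then have "regular_at \<alpha> (chart (flip k) (1 / t))" by (simp add: regular_at_chart)
      then have "regular_at \<alpha> (chart k t)" using t chart_flip[of "1 / t" k] by simp
      then show False using \<open>t \<in> S\<close> by (simp add: regular_at_chart S_def)
    qed
  qed
  moreover have "S sparse_in UNIV"
  proof -
    have "\<forall>\<^sub>\<approx>t\<in>UNIV. ?f analytic_on {t}"
      using coeff_props(2) by (rule meromorphic_on_imp_analytic_cosparse)
    then have "\<forall>\<^sub>\<approx>t\<in>UNIV. t \<notin> S"
      by eventually_elim (use analytic_at_imp_no_pole in \<open>auto simp: S_def\<close>)
    then show ?thesis by (simp add: eventually_cosparse)
  qed
  then have "S sparse_in cball 0 (1 / r)" by (rule sparse_in_subset) simp
  then have "finite (cball 0 (1 / r) \<inter> S)" by (rule sparse_in_compact_finite) simp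
  ultimately have S: "finite S" by (simp add: Int_absorb1)
  have "\<exists>n c. (\<lambda>t. (t - p) ^ n * ?f t) \<midarrow>p\<rightarrow> c" for p
    using nicely_meromorphic_mult_power_tendsto[OF coeff_props(1)] by metis
  then obtain N where N: "\<And>p. \<exists>c. (\<lambda>t. (t - p) ^ N p * ?f t) \<midarrow>p\<rightarrow> c" by metis
  obtain n c where "(\<lambda>w. (w - 0) ^ n * ?f' w) \<midarrow>0\<rightarrow> c"
    using nicely_meromorphic_mult_power_tendsto[OF coeff_props(1)] by metis
  then have "(\<lambda>w. - (w ^ 2) * ((w - 0) ^ n * ?f' w)) \<midarrow>0\<rightarrow> - (0 ^ 2) * c"
    by (intro tendsto_intros)
  moreover have "\<forall>\<^sub>F w in at 0. - (w ^ 2) * ((w - 0) ^ n * ?f' w) = w ^ n * ?f (1 / w)"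
    using eventually_neq_at_within[of 0 0 UNIV]
  proof eventually_elim
    case (elim w)
    then show ?case using form_coeff_flip[of "1 / w" \<alpha> k] by (simp add: field_simps)
  qed
  ultimately have lim: "(\<lambda>w. w ^ n * ?f (1 / w)) \<midarrow>0\<rightarrow> - (0 ^ 2) * c"
    by (simp add: tendsto_cong)
  have an: "?f analytic_on {t}" if "t \<notin> S" for t
    using that nicely_meromorphic_on_imp_analytic_at[OF coeff_props(1) UNIV_I] by (simp add: S_def)
  obtain P where P: "\<And>t. t \<notin> S \<Longrightarrow> ?f t * (\<Prod>p\<in>S. (t - p) ^ N p) = poly P t"
    by (rule rational_of_meromorphic_on_sphere[OF S an N lim]) (blast intro: that)+
  let ?Q = "\<Prod>p\<in>S. [:- p, 1:] ^ N p"
  have Q: "poly ?Q t = (\<Prod>p\<in>S. (t - p) ^ N p)" for t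
    by (simp add: poly_prod)
  show ?thesis
  proof
    show "finite S" by (rule S)
    show "?Q \<noteq> 0" using S by (simp add: pCons_eq_0_iff)
    show "\<not> is_pole ?f t \<and> poly ?Q t \<noteq> 0 \<and> ?f t = poly P t / poly ?Q t" if "t \<notin> S" for t
    proof -
      have "poly ?Q t \<noteq> 0" unfolding Q using S that by auto
      moreover have "?f t * poly ?Q t = poly P t"
        unfolding Q by (rule P[OF that])
      moreover have "\<not> is_pole ?f t" using that by (simp add: S_def)
      ultimately show ?thesis by (metis nonzero_eq_divide_eq)
    qed
  qed
qed

lemma finite_not_regular_at: "finite {p. \<not> regular_at \<alpha> p}"
proof -
  obtain S where S: "finite S" "\<And>t. t \<notin> S \<Longrightarrow> \<not> is_pole (form_coeff \<alpha> Std) t"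
    using form_coeff_rational[of \<alpha> Std] by metis
  have "{p. \<not> regular_at \<alpha> p} \<subseteq> insert (chart (flip Std) 0) (chart Std ` S)"
  proof
    fix p assume "p \<in> {p. \<not> regular_at \<alpha> p}"
    then show "p \<in> insert (chart (flip Std) 0) (chart Std ` S)"
      using S(2) by (cases p rule: chart_cases[where k = Std]) (auto simp: regular_at_chart simp del: chart.simps)
  qed
  then show ?thesis using S(1) finite_subset by blast
qed


section \<open>Coordinates are Moebius functions\<close>

text \<open>In the chart where its pole lies at a finite point \<open>t0\<close>, a coordinate is \<open>(a t + b) / (t - t0)\<close>; the
  origin of the other chart is not a pole, and the value there is \<open>a\<close>.\<close>

lemma coordinate_moebius:
  assumes "coordinate u"
  obtains k a b t0 where "b + a * t0 \<noteq> 0" "\<And>p. has_pole_at u p \<longleftrightarrow> p = chart k t0"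
    "\<And>t. t \<noteq> t0 \<Longrightarrow> u (chart k t) = (a * t + b) / (t - t0)"
    "\<And>w. w * t0 \<noteq> 1 \<Longrightarrow> u (chart (flip k) w) = (a + b * w) / (1 - t0 * w)"
proof -
  obtain p0 where p0: "\<And>p. has_pole_at u p \<longleftrightarrow> p = p0" and "simple_pole_at u p0"
    using assms unfolding coordinate_def by metis
  then obtain k t0 where k: "chart k t0 = p0" and pole: "is_pole (\<lambda>s. u (chart k s)) t0"
      and ord: "zorder (\<lambda>s. u (chart k s)) t0 = -1"
    unfolding simple_pole_at_def by metis
  let ?f = "\<lambda>s. u (chart k s)" and ?f' = "\<lambda>s. u (chart (flip k) s)"
  have mero: "(\<lambda>s. u (chart j s)) nicely_meromorphic_on UNIV" for j
    using assms by (auto simp: coordinate_def meromorphic_fun_def)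
  have an: "?f analytic_on {t}" if "t \<noteq> t0" for t
    using that p0[of "chart k t"] k has_pole_at_chart
    by (intro nicely_meromorphic_on_imp_analytic_at[OF mero UNIV_I]) auto
  have an': "?f' analytic_on {0}"
    using p0[of "chart (flip k) 0"] k has_pole_at_chart
    by (intro nicely_meromorphic_on_imp_analytic_at[OF mero UNIV_I]) auto
  then have "?f' \<midarrow>0\<rightarrow> ?f' 0"
    using analytic_at_imp_isCont isCont_def by blast
  moreover have ev0: "\<forall>\<^sub>F w in at (0::complex). w \<noteq> 0" by (simp add: eventually_at_filter)
  then have "\<forall>\<^sub>F w in at 0. ?f' w = ?f (1 / w)"
    by eventually_elim (simp add: chart_flip)
  ultimately have lim: "(\<lambda>w. ?f (1 / w)) \<midarrow>0\<rightarrow> ?f' 0"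
    by (simp add: tendsto_cong)
  \<comment> \<open>The pole is simple, so \<open>(t - t0) u\<close> has a limit at \<open>t0\<close>, and the general result gives degree at most 1.\<close>
  have "?f analytic_on UNIV - {t0}"
    using an by (subst analytic_on_analytic_at) blast
  then have "?f holomorphic_on UNIV - {t0}" by (rule analytic_imp_holomorphic)
  from zorder_exist_pole[OF this open_UNIV UNIV_I pole] obtain r where
    r: "r > 0" "zor_poly ?f t0 holomorphic_on cball t0 r"
    "\<forall>w\<in>cball t0 r - {t0}. ?f w = zor_poly ?f t0 w / (w - t0)"
    unfolding ord by auto
  have "zor_poly ?f t0 \<midarrow>t0\<rightarrow> zor_poly ?f t0 t0"
    using r by (metis ball_subset_cball centre_in_ball continuous_on_eq_continuous_at continuous_within
        holomorphic_on_imp_continuous_on holomorphic_on_subset open_ball)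
  moreover have "\<forall>\<^sub>F t in at t0. zor_poly ?f t0 t = (t - t0) ^ 1 * ?f t"
    unfolding eventually_at using r by (intro exI[of _ r]) (auto simp: dist_commute)
  ultimately have "(\<lambda>t. (t - t0) ^ 1 * ?f t) \<midarrow>t0\<rightarrow> zor_poly ?f t0 t0"
    by (simp add: tendsto_cong)
  then have "\<exists>c. (\<lambda>t. (t - p) ^ 1 * ?f t) \<midarrow>p\<rightarrow> c" if "p \<in> {t0}" for p
    using that by blast
  then obtain P where P: "degree P \<le> 1" "\<And>t. t \<noteq> t0 \<Longrightarrow> ?f t * (t - t0) = poly P t"
    using rational_of_meromorphic_on_sphere[of "{t0}" ?f "\<lambda>_. 1" 0 "?f' 0"] an lim by auto
  define a b where "a = coeff P 1" and "b = coeff P 0"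
  have "P = [:b, a:]"
    using P(1) by (intro poly_eqI) (auto simp: a_def b_def coeff_pCons coeff_eq_0 split: nat.splits)
  then have "poly P t = a * t + b" for t
    by (simp add: algebra_simps)
  then have f: "?f t = (a * t + b) / (t - t0)" if "t \<noteq> t0" for t
    using P(2)[OF that] that by (simp add: field_simps)
  have nd: "b + a * t0 \<noteq> 0"
  proof
    assume 0: "b + a * t0 = 0"
    have "\<forall>\<^sub>F t in at t0. t \<noteq> t0" by (simp add: eventually_at_filter)
    then have "\<forall>\<^sub>F t in at t0. ?f t = a"
    proof eventually_elim
      case (elim t)
      have "a * t + b = a * (t - t0)" using 0 by (simp add: algebra_simps add_eq_0_iff)
      then show ?case using f[OF elim] elim by simp
    qed
    then have "is_pole (\<lambda>_. a) t0 = is_pole ?f t0" by (intro is_pole_cong) (auto simp: eq_commute)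
    then show False using pole by simp
  qed
  have f': "?f' w = (a + b * w) / (1 - t0 * w)" if "w \<noteq> 0" "w * t0 \<noteq> 1" for w
  proof -
    have "1 / w \<noteq> t0" using that by auto
    moreover have "a * (1 / w) + b = (a + b * w) / w" "1 / w - t0 = (1 - t0 * w) / w"
      using that by (simp_all add: field_simps)
    ultimately show ?thesis using f[of "1 / w"] that by (simp add: chart_flip)
  qed
  have "(\<lambda>w. (a + b * w) / (1 - t0 * w)) \<midarrow>0\<rightarrow> (a + b * 0) / (1 - t0 * 0)"
    by (intro tendsto_intros) auto
  moreover have "\<forall>\<^sub>F w in at 0. w * t0 \<noteq> 1"
  proof -
    have "(\<lambda>w. w * t0) \<midarrow>0\<rightarrow> 0 * t0" by (intro tendsto_intros)
    then show ?thesis by (rule tendsto_imp_eventually_ne) simp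
  qed
  with ev0 have "\<forall>\<^sub>F w in at 0. (a + b * w) / (1 - t0 * w) = ?f' w"
    by eventually_elim (simp add: f')
  ultimately have "?f' \<midarrow>0\<rightarrow> a"
    by (simp add: tendsto_cong)
  then have "?f' 0 = a"
    using \<open>?f' \<midarrow>0\<rightarrow> ?f' 0\<close> LIM_unique by blast
  then have "?f' w = (a + b * w) / (1 - t0 * w)" if "w * t0 \<noteq> 1" for w
    using f'[OF _ that] by (cases "w = 0") auto
  then show ?thesis
    using that nd p0 k f by metis
qed

lemma moebius_chart:
  assumes "coordinate u"
  obtains a b c d where "a * d - b * c \<noteq> 0"
    "\<And>t. has_pole_at u (chart k t) \<longleftrightarrow> c * t + d = 0"
    "\<And>t. c * t + d \<noteq> 0 \<Longrightarrow> u (chart k t) = (a * t + b) / (c * t + d)"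
proof -
  obtain k0 a b t0 where *: "b + a * t0 \<noteq> 0" "\<And>p. has_pole_at u p \<longleftrightarrow> p = chart k0 t0"
    "\<And>t. t \<noteq> t0 \<Longrightarrow> u (chart k0 t) = (a * t + b) / (t - t0)"
    "\<And>w. w * t0 \<noteq> 1 \<Longrightarrow> u (chart (flip k0) w) = (a + b * w) / (1 - t0 * w)"
    by (rule coordinate_moebius[OF assms]) (rule that)
  show ?thesis
  proof (cases "k = k0")
    case True
    show ?thesis
      by (rule that[of a "- t0" b 1]) (use * True in \<open>auto simp: algebra_simps add_eq_0_iff\<close>)
  next
    case False
    then have k: "k = flip k0" by (cases k; cases k0) auto
    have "chart k w = chart k0 t0 \<longleftrightarrow> w * t0 = 1" for w
      using chart_flip[of w k0] k by (cases "w = 0") (auto simp: field_simps)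
    then show ?thesis
      by (intro that[of b 1 a "- t0"]) (use * k in \<open>auto simp: algebra_simps add_eq_0_iff\<close>)
  qed
qed

lemma coordinate_inject:
  assumes "coordinate u" "\<not> has_pole_at u p" "\<not> has_pole_at u q" "u p = u q"
  shows "p = q"
proof -
  obtain k a b t0 where *: "b + a * t0 \<noteq> 0" "\<And>p. has_pole_at u p \<longleftrightarrow> p = chart k t0"
    "\<And>t. t \<noteq> t0 \<Longrightarrow> u (chart k t) = (a * t + b) / (t - t0)"
    "\<And>w. w * t0 \<noteq> 1 \<Longrightarrow> u (chart (flip k) w) = (a + b * w) / (1 - t0 * w)"
    by (rule coordinate_moebius[OF assms(1)]) (rule that)
  have val: "(t - t0) * (u (chart k t) - a) = b + a * t0" if "t \<noteq> t0" for t
    using *(3)[OF that] that by (simp add: field_simps)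
  have at0: "u (chart (flip k) 0) = a" using *(4)[of 0] by simp
  have at0_iff: "u r = a \<longleftrightarrow> r = chart (flip k) 0" if "\<not> has_pole_at u r" for r
  proof (cases r rule: chart_cases[where k = k])
    case (1 t)
    then have "t \<noteq> t0" using that *(2) by auto
    then show ?thesis using val[of t] *(1) 1 by auto
  qed (simp add: at0)
  show ?thesis
  proof (cases "u p = a")
    case True
    then have "p = chart (flip k) 0" using at0_iff[OF assms(2)] by blast
    moreover have "q = chart (flip k) 0" using True assms(4) at0_iff[OF assms(3)] by argo
    ultimately show ?thesis by simp
  next
    case False
    then obtain s t where st: "p = chart k s" "q = chart k t"
      using at0_iff[OF assms(2)] at0_iff[OF assms(3)] assms(4) chart_cases[of p k] chart_cases[of q k] by metis
    then have "(s - t0) * (u p - a) = (t - t0) * (u p - a)"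
      using val[of s] val[of t] assms *(2) by simp
    then show ?thesis using False st by simp
  qed
qed

lemma coordinate_deriv:
  assumes "coordinate u" "\<not> has_pole_at u (chart k t)"
  shows "(\<lambda>s. u (chart k s)) analytic_on {t}" "deriv (\<lambda>s. u (chart k s)) t \<noteq> 0"
proof -
  show an: "(\<lambda>s. u (chart k s)) analytic_on {t}"
    using assms by (intro nicely_meromorphic_on_imp_analytic_at[of _ UNIV])
      (auto simp: coordinate_def meromorphic_fun_def has_pole_at_chart)
  obtain a b c d where *: "a * d - b * c \<noteq> 0"
    "\<And>t. has_pole_at u (chart k t) \<longleftrightarrow> c * t + d = 0"
    "\<And>t. c * t + d \<noteq> 0 \<Longrightarrow> u (chart k t) = (a * t + b) / (c * t + d)"
    by (rule moebius_chart[OF assms(1)]) (rule that)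
  have t: "c * t + d \<noteq> 0" using assms(2) * by simp
  have "((\<lambda>s. (a * s + b) / (c * s + d)) has_field_derivative (a * d - b * c) / (c * t + d) ^ 2) (at t)"
    using t by (auto intro!: derivative_eq_intros simp: field_simps power2_eq_square)
  moreover have "\<forall>\<^sub>F s in nhds t. (a * s + b) / (c * s + d) = u (chart k s)"
  proof -
    have "open {s. c * s + d \<noteq> 0}" by (intro open_Collect_neq continuous_intros)
    then have "\<forall>\<^sub>F s in nhds t. s \<in> {s. c * s + d \<noteq> 0}"
      using t by (intro eventually_nhds_in_open) auto
    then show ?thesis by eventually_elim (simp add: *(3))
  qed
  ultimately have "((\<lambda>s. u (chart k s)) has_field_derivative (a * d - b * c) / (c * t + d) ^ 2) (at t)"
    by (subst (asm) DERIV_cong_ev[OF refl _ refl])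
  then show "deriv (\<lambda>s. u (chart k s)) t \<noteq> 0"
    using t *(1) by (simp add: DERIV_imp_deriv)
qed

lemma form_value_chart:
  assumes "coordinate u" "\<not> has_pole_at u (chart k t)"
  shows "form_value u \<alpha> (chart k t) = form_coeff \<alpha> k t / deriv (\<lambda>s. u (chart k s)) t"
proof (cases "k = Std \<or> t = 0")
  case True
  then show ?thesis by (cases k) auto
next
  case False
  then have k: "k = AtInf" and t: "t \<noteq> 0" by (cases k; auto)+
  let ?g = "\<lambda>s. u (chart Std s)"
  have "\<not> has_pole_at u (chart Std (1 / t))" using assms(2) k t by simp
  then have "?g analytic_on {1 / t}" by (rule coordinate_deriv(1)[OF assms(1)])
  then have g: "(?g has_field_derivative deriv ?g (1 / t)) (at (1 / t))"
    by (simp add: analytic_on_imp_differentiable_at DERIV_deriv_iff_field_differentiable)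
  have i: "((\<lambda>s. 1 / s) has_field_derivative (- 1 / t ^ 2)) (at t)"
    using t by (auto intro!: derivative_eq_intros simp: power2_eq_square)
  have "((\<lambda>s. ?g (1 / s)) has_field_derivative deriv ?g (1 / t) * (- 1 / t ^ 2)) (at t)"
    using DERIV_chain2[OF g i] .
  moreover have "\<forall>\<^sub>F s in nhds t. ?g (1 / s) = u (chart AtInf s)"
    using t1_space_nhds[OF t] by eventually_elim simp
  ultimately have "((\<lambda>s. u (chart AtInf s)) has_field_derivative deriv ?g (1 / t) * (- 1 / t ^ 2)) (at t)"
    by (subst (asm) DERIV_cong_ev[OF refl _ refl])
  then have "deriv (\<lambda>s. u (chart AtInf s)) t = deriv ?g (1 / t) * (- 1 / t ^ 2)"
    by (rule DERIV_imp_deriv)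
  then show ?thesis
    using t form_coeff_flip[of "1 / t" \<alpha> Std] by (simp add: k power_divide)
qed

lemma e_form_regular_value:
  assumes u: "coordinate u" and z: "\<not> has_pole_at u z" and p: "\<not> has_pole_at u p" and "u p \<noteq> u z"
  shows "regular_at (e_form u z) p" "form_value u (e_form u z) p = - 1 / (u p - u z) ^ 2"
proof -
  obtain k t where kt: "p = chart k t"
    by (metis chart_cases)
  let ?u = "\<lambda>s. u (chart k s)"
  let ?g = "\<lambda>t. - deriv ?u t / (u (chart k t) - u z) ^ 2"
  note an = coordinate_deriv[OF u p[unfolded kt]]
  have "?g analytic_on {t}"
    using an assms(4) kt by (intro analytic_intros) (auto intro: analytic_deriv)
  moreover have c: "form_coeff (e_form u z) k = remove_sings ?g"
    using u by (intro coeff_e_form) (simp add: coordinate_def)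
  ultimately have *: "form_coeff (e_form u z) k analytic_on {t}" "form_coeff (e_form u z) k t = ?g t"
    by (simp_all add: remove_sings_analytic_on remove_sings_at_analytic)
  then show "regular_at (e_form u z) p"
    by (simp add: kt regular_at_chart analytic_at_imp_no_pole)
  show "form_value u (e_form u z) p = - 1 / (u p - u z) ^ 2"
    using form_value_chart[OF u p[unfolded kt]] * an(2) by (simp add: kt)
qed


section \<open>Values of forms as rational functions of a coordinate\<close>

lemma poly_moebius_compose:
  fixes a b c :: complex
  obtains P' n where "\<And>y. y \<noteq> a \<Longrightarrow> poly P ((b + c * y) / (y - a)) = poly P' y / (y - a) ^ n"
proof -
  have "\<exists>P' n. \<forall>y. y \<noteq> a \<longrightarrow> poly P ((b + c * y) / (y - a)) = poly P' y / (y - a) ^ n"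
  proof (induction P)
    case 0
    show ?case by (intro exI[of _ 0] exI[of _ 0]) simp
  next
    case (pCons e P)
    then obtain P' n where ih: "\<And>y. y \<noteq> a \<Longrightarrow> poly P ((b + c * y) / (y - a)) = poly P' y / (y - a) ^ n"
      by blast
    have "poly (pCons e P) ((b + c * y) / (y - a)) =
        poly (smult e ([:- a, 1:] ^ Suc n) + [:b, c:] * P') y / (y - a) ^ Suc n" if "y \<noteq> a" for y
    proof -
      have "poly (pCons e P) ((b + c * y) / (y - a)) = e + (b + c * y) / (y - a) * (poly P' y / (y - a) ^ n)"
        by (simp add: ih[OF that])
      also have "\<dots> = (e * (y - a) ^ Suc n + (b + c * y) * poly P' y) / (y - a) ^ Suc n"
        using that by (simp add: divide_simps)
      finally show ?thesis by (simp add: algebra_simps)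
    qed
    then show ?case by blast
  qed
  then show ?thesis using that by blast
qed

text \<open>A first, crude version: the relation is only claimed outside a finite set, which absorbs the pole of
  \<open>u\<close>, the poles of the form and the point missed by the chart. It is stated without division, so that it
  can be extended by continuity.\<close>

lemma form_value_rational_cofinite:
  assumes u: "coordinate u"
  obtains P Q F where "finite F" "Q \<noteq> 0"
    "\<And>p. p \<notin> F \<Longrightarrow> \<not> has_pole_at u p \<and> form_value u \<alpha> p * poly Q (u p) = poly P (u p)"
proof -
  obtain k a b t0 where *: "b + a * t0 \<noteq> 0" "\<And>p. has_pole_at u p \<longleftrightarrow> p = chart k t0"
    "\<And>t. t \<noteq> t0 \<Longrightarrow> u (chart k t) = (a * t + b) / (t - t0)"
    "\<And>w. w * t0 \<noteq> 1 \<Longrightarrow> u (chart (flip k) w) = (a + b * w) / (1 - t0 * w)"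
    by (rule coordinate_moebius[OF assms(1)]) (rule that)
  define D where "D = b + a * t0"
  obtain S P0 Q0 where S: "finite S" "Q0 \<noteq> 0"
    "\<And>t. t \<notin> S \<Longrightarrow> \<not> is_pole (form_coeff \<alpha> k) t \<and> poly Q0 t \<noteq> 0 \<and> form_coeff \<alpha> k t = poly P0 t / poly Q0 t"
    by (rule form_coeff_rational) (rule that)
  obtain P1 n where P1: "\<And>y. y \<noteq> a \<Longrightarrow> poly P0 ((b + t0 * y) / (y - a)) = poly P1 y / (y - a) ^ n"
    by (rule poly_moebius_compose[of a]) (rule that)
  obtain Q1 m where Q1: "\<And>y. y \<noteq> a \<Longrightarrow> poly Q0 ((b + t0 * y) / (y - a)) = poly Q1 y / (y - a) ^ m"
    by (rule poly_moebius_compose[of a]) (rule that)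
  have inv: "u (chart k t) \<noteq> a \<and> t = (b + t0 * u (chart k t)) / (u (chart k t) - a) \<and>
      deriv (\<lambda>s. u (chart k s)) t = - ((u (chart k t) - a) ^ 2 / D)" if t: "t \<noteq> t0" for t
  proof -
    let ?y = "u (chart k t)"
    have y: "(t - t0) * (?y - a) = D" using *(3)[OF t] t by (simp add: field_simps D_def)
    then have "?y \<noteq> a" using * D_def by auto
    have "t * (?y - a) = b + t0 * ?y" using y by (simp add: D_def algebra_simps)
    then have "t = (b + t0 * ?y) / (?y - a)" using \<open>?y \<noteq> a\<close> by (simp add: nonzero_eq_divide_eq)
    moreover have der: "deriv (\<lambda>s. u (chart k s)) t = - (D / (t - t0) ^ 2)"
    proof -
      have "a * (t - t0) - (a * t + b) = - D" by (simp add: D_def algebra_simps)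
      then have "((\<lambda>s. (a * s + b) / (s - t0)) has_field_derivative - (D / (t - t0) ^ 2)) (at t)"
        using t by (auto intro!: derivative_eq_intros simp: power2_eq_square)
      moreover have "\<forall>\<^sub>F s in nhds t. (a * s + b) / (s - t0) = u (chart k s)"
        using t1_space_nhds[OF t] by eventually_elim (simp add: *(3))
      ultimately have "((\<lambda>s. u (chart k s)) has_field_derivative - (D / (t - t0) ^ 2)) (at t)"
        by (subst (asm) DERIV_cong_ev[OF refl _ refl])
      then show ?thesis by (rule DERIV_imp_deriv)
    qed
    moreover have "t - t0 = D / (?y - a)" using y \<open>?y \<noteq> a\<close> by (simp add: nonzero_eq_divide_eq)
    then have "deriv (\<lambda>s. u (chart k s)) t = - ((?y - a) ^ 2 / D)"
      using *(1) unfolding der D_def[symmetric] by (simp add: power_divide power2_eq_square)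
    ultimately show ?thesis using \<open>?y \<noteq> a\<close> by blast
  qed
  show ?thesis
  proof (rule that)
    let ?F = "{chart k t0, chart (flip k) 0} \<union> chart k ` S"
    let ?P = "smult (- D) (P1 * [:- a, 1:] ^ m)" and ?Q = "Q1 * [:- a, 1:] ^ (n + 2)"
    show "finite ?F" using S by simp
    have fin: "t \<notin> S \<Longrightarrow> t \<noteq> t0 \<Longrightarrow> poly Q1 (u (chart k t)) \<noteq> 0" for t
      using S(3)[of t] inv[of t] Q1[of "u (chart k t)"] by auto
    obtain t where "t \<notin> insert t0 S"
      using ex_new_if_finite[OF infinite_UNIV_char_0, of "insert t0 S"] S by auto
    then have "Q1 \<noteq> 0" using fin[of t] by auto
    then show "?Q \<noteq> 0" by (simp only: mult_eq_0_iff power_eq_0_iff) simp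
    fix p assume p: "p \<notin> ?F"
    then obtain t where t: "p = chart k t" "t \<noteq> t0" "t \<notin> S"
      by (cases p rule: chart_cases[where k = k]) auto
    let ?y = "u (chart k t)"
    have "form_value u \<alpha> p = form_coeff \<alpha> k t / deriv (\<lambda>s. u (chart k s)) t"
      using t * form_value_chart[OF u] by simp
    also have "\<dots> = (poly P1 ?y / (?y - a) ^ n) / (poly Q1 ?y / (?y - a) ^ m) / (- ((?y - a) ^ 2 / D))"
      using S(3)[OF t(3)] P1[of ?y] Q1[of ?y] inv[OF t(2)] by metis
    also have "\<dots> * poly ?Q ?y = poly ?P ?y"
    proof -
      have identity: "(A / X ^ n) / (B / X ^ m) / (- (X ^ 2 / D)) * (B * X ^ (n + 2)) = - D * (A * X ^ m)"
        if "X \<noteq> 0" "B \<noteq> 0" for A B X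
        using that *(1) unfolding D_def[symmetric] by (simp add: power_add power2_eq_square field_simps)
      have lin: "poly [:- a, 1:] ?y = ?y - a" by simp
      show ?thesis
        unfolding poly_mult poly_power poly_smult lin
        by (rule identity) (use inv[OF t(2)] fin[OF t(3,2)] in auto)
    qed
    finally show "\<not> has_pole_at u p \<and> form_value u \<alpha> p * poly ?Q (u p) = poly ?P (u p)"
      using t * by simp
  qed
qed

lemma form_value_continuous:
  assumes u: "coordinate u" and z: "\<not> has_pole_at u (chart k t)" and \<alpha>: "regular_at \<alpha> (chart k t)"
  shows "((\<lambda>s. form_value u \<alpha> (chart k s)) \<longlongrightarrow> form_value u \<alpha> (chart k t)) (at t)"
    "((\<lambda>s. u (chart k s)) \<longlongrightarrow> u (chart k t)) (at t)"
proof -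
  let ?u = "\<lambda>s. u (chart k s)"
  note an = coordinate_deriv[OF u z]
  show "?u \<midarrow>t\<rightarrow> ?u t"
    using an(1) analytic_at_imp_isCont isCont_def by blast
  have "form_coeff \<alpha> k \<midarrow>t\<rightarrow> form_coeff \<alpha> k t"
    using coeff_analytic[OF \<alpha>] analytic_at_imp_isCont isCont_def by blast
  moreover have "deriv ?u \<midarrow>t\<rightarrow> deriv ?u t"
    using analytic_deriv[OF an(1)] analytic_at_imp_isCont isCont_def by blast
  ultimately have "(\<lambda>s. form_coeff \<alpha> k s / deriv ?u s) \<midarrow>t\<rightarrow> form_coeff \<alpha> k t / deriv ?u t"
    using an(2) by (intro tendsto_intros)
  moreover have "\<forall>\<^sub>F s in at t. form_coeff \<alpha> k s / deriv ?u s = form_value u \<alpha> (chart k s)"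
  proof -
    obtain S where S: "open S" "t \<in> S" "?u holomorphic_on S"
      using an(1) unfolding analytic_at by blast
    from S(1,2) have "\<forall>\<^sub>F s in at t. s \<in> S" by (rule eventually_at_in_open')
    then show ?thesis
    proof eventually_elim
      case (elim s)
      then have "?u analytic_on {s}" using S unfolding analytic_at by blast
      then have "\<not> has_pole_at u (chart k s)"
        by (simp add: has_pole_at_chart analytic_at_imp_no_pole)
      then show ?case using form_value_chart[OF u] by simp
    qed
  qed
  ultimately show "((\<lambda>s. form_value u \<alpha> (chart k s)) \<longlongrightarrow> form_value u \<alpha> (chart k t)) (at t)"
    using form_value_chart[OF u z] by (simp add: tendsto_cong)
qed

text \<open>The quotient can be chosen so that its denominator vanishes exactly outside \<open>N\<close>. In a representation
  with a denominator of least degree, numerator and denominator have no common zero. At a point where the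
  form is regular the relation between them persists by continuity, so the denominator does not vanish
  there. Then both are multiplied by a polynomial with zeros at the points outside \<open>N\<close>.\<close>

lemma form_value_rational:
  assumes u: "coordinate u" and N: "finite (- N)" "\<And>p. p \<in> N \<Longrightarrow> \<not> has_pole_at u p"
    and reg: "\<And>p. p \<in> N \<Longrightarrow> regular_at \<alpha> p"
  obtains P Q where "\<And>p. \<not> has_pole_at u p \<Longrightarrow> poly Q (u p) \<noteq> 0 \<longleftrightarrow> p \<in> N"
    "\<And>p. p \<in> N \<Longrightarrow> form_value u \<alpha> p = poly P (u p) / poly Q (u p)"
proof -
  \<comment> \<open>Minimality of the degree of \<open>Q\<close> replaces coprimality of \<open>P\<close> and \<open>Q\<close>.\<close>
  let ?rep = "\<lambda>P Q. Q \<noteq> 0 \<and> (\<exists>F. finite F \<and> (\<forall>p. p \<notin> F \<longrightarrow>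
    \<not> has_pole_at u p \<and> form_value u \<alpha> p * poly Q (u p) = poly P (u p)))"
  have "\<exists>d P Q. ?rep P Q \<and> degree Q = d"
    by (rule form_value_rational_cofinite[OF u, of \<alpha>]) blast
  then have "\<exists>P Q. ?rep P Q \<and> degree Q = (LEAST d. \<exists>P Q. ?rep P Q \<and> degree Q = d)"
    by (rule LeastI_ex)
  then obtain P Q where rep: "?rep P Q" and deg: "degree Q = (LEAST d. \<exists>P Q. ?rep P Q \<and> degree Q = d)"
    by blast
  have min: "degree Q \<le> degree Q'" if "?rep P' Q'" for P' Q'
    unfolding deg using that by (intro Least_le) blast
  obtain F where F: "finite F" "\<And>p. p \<notin> F \<Longrightarrow> \<not> has_pole_at u p \<and> form_value u \<alpha> p * poly Q (u p) = poly P (u p)"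
    using rep by blast
  have eq: "form_value u \<alpha> p * poly Q (u p) = poly P (u p)" if p: "p \<in> N" for p
  proof -
    obtain k t where kt: "p = chart k t" by (metis chart_cases)
    note lim = form_value_continuous[OF u N(2)[OF p, unfolded kt] reg[OF p, unfolded kt]]
    have "(\<lambda>s. form_value u \<alpha> (chart k s) * poly Q (u (chart k s))) \<midarrow>t\<rightarrow>
        form_value u \<alpha> p * poly Q (u p)"
      unfolding kt by (intro tendsto_intros lim)
    moreover have "finite {s. chart k s \<in> F}"
      using finite_vimageI[OF F(1), of "chart k"] by (simp add: inj_def vimage_def)
    then have "\<forall>\<^sub>F s in at t. s \<notin> {s. chart k s \<in> F}"
      by (rule eventually_not_in_finite)
    then have "\<forall>\<^sub>F s in at t. form_value u \<alpha> (chart k s) * poly Q (u (chart k s)) = poly P (u (chart k s))"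
      by eventually_elim (use F(2) in simp)
    ultimately have "(\<lambda>s. poly P (u (chart k s))) \<midarrow>t\<rightarrow> form_value u \<alpha> p * poly Q (u p)"
      by (simp add: tendsto_cong)
    moreover have "(\<lambda>s. poly P (u (chart k s))) \<midarrow>t\<rightarrow> poly P (u p)"
      unfolding kt by (intro tendsto_intros lim)
    ultimately show ?thesis by (rule LIM_unique)
  qed
  have Q: "poly Q (u p) \<noteq> 0" if p: "p \<in> N" for p
  proof
    assume 0: "poly Q (u p) = 0"
    then have "poly P (u p) = 0" using eq[OF p] by simp
    then obtain P' Q' where PQ: "P = [:- u p, 1:] * P'" "Q = [:- u p, 1:] * Q'"
      using 0 by (metis poly_eq_0_iff_dvd dvdE)
    then have "Q' \<noteq> 0" using rep by auto
    moreover have "form_value u \<alpha> q * poly Q' (u q) = poly P' (u q)" if "q \<notin> insert p F" for q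
    proof -
      have "u q \<noteq> u p" using coordinate_inject[OF u, of q p] F(2)[of q] N(2)[OF p] that by auto
      moreover have "(u q - u p) * (form_value u \<alpha> q * poly Q' (u q)) = (u q - u p) * poly P' (u q)"
        using F(2)[of q] that by (simp add: PQ algebra_simps)
      ultimately show ?thesis by simp
    qed
    ultimately have "?rep P' Q'"
      using F by (intro conjI exI[of _ "insert p F"]) auto
    then have "degree Q \<le> degree Q'" by (rule min)
    moreover have "degree Q = Suc (degree Q')"
      using \<open>Q' \<noteq> 0\<close> by (simp add: PQ degree_mult_eq del: mult_pCons_left)
    ultimately show False by simp
  qed
  let ?M = "{p. p \<notin> N \<and> \<not> has_pole_at u p}"
  have M: "finite ?M" by (rule finite_subset[OF _ N(1)]) auto
  define E where "E = (\<Prod>p\<in>?M. [:- u p, 1:])"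
  have E: "poly E y = (\<Prod>p\<in>?M. y - u p)" for y
    by (simp add: E_def poly_prod)
  have E0: "poly E (u p) \<noteq> 0 \<longleftrightarrow> p \<in> N" if "\<not> has_pole_at u p" for p
  proof -
    have "poly E (u p) = 0 \<longleftrightarrow> (\<exists>q\<in>?M. u p = u q)" unfolding E using M by auto
    also have "\<dots> \<longleftrightarrow> p \<notin> N" using coordinate_inject[OF u that] that by blast
    finally show ?thesis by blast
  qed
  show ?thesis
  proof (rule that[of "Q * E" "P * E"])
    show "poly (Q * E) (u p) \<noteq> 0 \<longleftrightarrow> p \<in> N" if "\<not> has_pole_at u p" for p
      using E0[OF that] Q by auto
    show "form_value u \<alpha> p = poly (P * E) (u p) / poly (Q * E) (u p)" if "p \<in> N" for p
      using eq[OF that] Q[OF that] E0[OF N(2)[OF that]] that by (simp add: field_simps)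
  qed
qed


section \<open>Rational families\<close>

text \<open>\<open>rational_values u N m A g\<close>: the number \<open>g z x\<close>, which depends on \<open>z \<in> N\<close> and on \<open>m\<close> points \<open>x\<close>, is a
  rational function \<open>P / Q\<close> of \<open>u z\<close> and the \<open>u (x i)\<close>, and the side condition \<open>A z x\<close> holds wherever
  \<open>Q\<close> does not vanish. For every \<open>z \<in> N\<close> the denominator is nonzero as soon as the other variables avoid
  a finite set; unlike mere nonvanishing somewhere, this passes to products trivially.\<close>

definition rational_values ::
  "(pline \<Rightarrow> complex) \<Rightarrow> pline set \<Rightarrow> nat \<Rightarrow> (pline \<Rightarrow> (nat \<Rightarrow> pline) \<Rightarrow> bool) \<Rightarrow>
     (pline \<Rightarrow> (nat \<Rightarrow> pline) \<Rightarrow> complex) \<Rightarrow> bool" where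
  "rational_values u N m A g \<longleftrightarrow> (\<exists>P\<in>poly_funs (Suc m). \<exists>Q\<in>poly_funs (Suc m).
     (\<forall>z\<in>N. \<exists>S. finite S \<and> (\<forall>y. y 0 = u z \<longrightarrow> (\<forall>i<m. y (Suc i) \<notin> S) \<longrightarrow> Q y \<noteq> 0)) \<and>
     (\<forall>z\<in>N. \<forall>x. (\<forall>i<m. \<not> has_pole_at u (x i)) \<longrightarrow> Q (case_nat (u z) (\<lambda>i. u (x i))) \<noteq> 0 \<longrightarrow>
        A z x \<and> g z x = P (case_nat (u z) (\<lambda>i. u (x i))) / Q (case_nat (u z) (\<lambda>i. u (x i)))))"

lemma rational_valuesI:
  assumes "P \<in> poly_funs (Suc m)" "Q \<in> poly_funs (Suc m)"
    "\<And>z. z \<in> N \<Longrightarrow> \<exists>S. finite S \<and> (\<forall>y. y 0 = u z \<longrightarrow> (\<forall>i<m. y (Suc i) \<notin> S) \<longrightarrow> Q y \<noteq> 0)"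
    "\<And>z x y. z \<in> N \<Longrightarrow> \<forall>i<m. \<not> has_pole_at u (x i) \<Longrightarrow> y = case_nat (u z) (\<lambda>i. u (x i)) \<Longrightarrow> Q y \<noteq> 0 \<Longrightarrow>
        A z x \<and> g z x = P y / Q y"
  shows "rational_values u N m A g"
  unfolding rational_values_def
  by (intro bexI[OF _ assms(1)] bexI[OF _ assms(2)] conjI ballI allI impI assms(3)) (use assms(4) in auto)

lemma rational_valuesE:
  assumes "rational_values u N m A g"
  obtains P Q where "P \<in> poly_funs (Suc m)" "Q \<in> poly_funs (Suc m)"
    "\<And>z. z \<in> N \<Longrightarrow> \<exists>S. finite S \<and> (\<forall>y. y 0 = u z \<longrightarrow> (\<forall>i<m. y (Suc i) \<notin> S) \<longrightarrow> Q y \<noteq> 0)"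
    "\<And>z x y. z \<in> N \<Longrightarrow> \<forall>i<m. \<not> has_pole_at u (x i) \<Longrightarrow> y = case_nat (u z) (\<lambda>i. u (x i)) \<Longrightarrow> Q y \<noteq> 0 \<Longrightarrow>
        A z x \<and> g z x = P y / Q y"
proof -
  from assms[unfolded rational_values_def] obtain P Q where PQ: "P \<in> poly_funs (Suc m)" "Q \<in> poly_funs (Suc m)"
    "\<forall>z\<in>N. \<exists>S. finite S \<and> (\<forall>y. y 0 = u z \<longrightarrow> (\<forall>i<m. y (Suc i) \<notin> S) \<longrightarrow> Q y \<noteq> 0)"
    "\<forall>z\<in>N. \<forall>x. (\<forall>i<m. \<not> has_pole_at u (x i)) \<longrightarrow> Q (case_nat (u z) (\<lambda>i. u (x i))) \<noteq> 0 \<longrightarrow>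
        A z x \<and> g z x = P (case_nat (u z) (\<lambda>i. u (x i))) / Q (case_nat (u z) (\<lambda>i. u (x i)))"
    by (elim bexE conjE)
  show ?thesis
    by (rule that[OF PQ(1,2) PQ(3)[rule_format]]) (use PQ(4) in auto)
qed

lemma rational_values_weaken:
  assumes "rational_values u N m A g"
    "\<And>z x. z \<in> N \<Longrightarrow> A z x \<Longrightarrow> B z x \<and> h z x = g z x"
  shows "rational_values u N m B h"
  using assms(1)
proof (rule rational_valuesE)
  fix P Q
  assume PQ: "P \<in> poly_funs (Suc m)" "Q \<in> poly_funs (Suc m)"
    "\<And>z. z \<in> N \<Longrightarrow> \<exists>S. finite S \<and> (\<forall>y. y 0 = u z \<longrightarrow> (\<forall>i<m. y (Suc i) \<notin> S) \<longrightarrow> Q y \<noteq> 0)"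
    "\<And>z x y. z \<in> N \<Longrightarrow> \<forall>i<m. \<not> has_pole_at u (x i) \<Longrightarrow> y = case_nat (u z) (\<lambda>i. u (x i)) \<Longrightarrow> Q y \<noteq> 0 \<Longrightarrow>
        A z x \<and> g z x = P y / Q y"
  show ?thesis
  proof (rule rational_valuesI[OF PQ(1,2,3)])
    fix z x y
    assume *: "z \<in> N" "\<forall>i<m. \<not> has_pole_at u (x i)" "y = case_nat (u z) (\<lambda>i. u (x i))" "Q y \<noteq> 0"
    show "B z x \<and> h z x = P y / Q y"
      using PQ(4)[OF *] assms(2)[OF *(1), of x] by simp
  qed
qed

lemma poly_funs_poly: "G \<in> poly_funs n \<Longrightarrow> (\<lambda>y. poly p (G y)) \<in> poly_funs n"
  by (induction p) (auto intro: poly_funs.intros)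

lemma
  assumes "rational_values u N m A g" "rational_values u N m B h"
  shows rational_values_add: "rational_values u N m (\<lambda>z x. A z x \<and> B z x) (\<lambda>z x. g z x + h z x)"
    and rational_values_mult: "rational_values u N m (\<lambda>z x. A z x \<and> B z x) (\<lambda>z x. g z x * h z x)"
proof -
  obtain P Q where P: "P \<in> poly_funs (Suc m)" "Q \<in> poly_funs (Suc m)"
    "\<And>z. z \<in> N \<Longrightarrow> \<exists>S. finite S \<and> (\<forall>y. y 0 = u z \<longrightarrow> (\<forall>i<m. y (Suc i) \<notin> S) \<longrightarrow> Q y \<noteq> 0)"
    "\<And>z x y. z \<in> N \<Longrightarrow> \<forall>i<m. \<not> has_pole_at u (x i) \<Longrightarrow> y = case_nat (u z) (\<lambda>i. u (x i)) \<Longrightarrow> Q y \<noteq> 0 \<Longrightarrow>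
        A z x \<and> g z x = P y / Q y"
    by (rule rational_valuesE[OF assms(1)]) (rule that)
  obtain P' Q' where P': "P' \<in> poly_funs (Suc m)" "Q' \<in> poly_funs (Suc m)"
    "\<And>z. z \<in> N \<Longrightarrow> \<exists>S. finite S \<and> (\<forall>y. y 0 = u z \<longrightarrow> (\<forall>i<m. y (Suc i) \<notin> S) \<longrightarrow> Q' y \<noteq> 0)"
    "\<And>z x y. z \<in> N \<Longrightarrow> \<forall>i<m. \<not> has_pole_at u (x i) \<Longrightarrow> y = case_nat (u z) (\<lambda>i. u (x i)) \<Longrightarrow> Q' y \<noteq> 0 \<Longrightarrow>
        B z x \<and> h z x = P' y / Q' y"
    by (rule rational_valuesE[OF assms(2)]) (rule that)
  have Q: "(\<lambda>y. Q y * Q' y) \<in> poly_funs (Suc m)"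
    by (intro poly_funs_mult P P')
  have gen: "\<exists>S. finite S \<and> (\<forall>y. y 0 = u z \<longrightarrow> (\<forall>i<m. y (Suc i) \<notin> S) \<longrightarrow> Q y * Q' y \<noteq> 0)"
    if z: "z \<in> N" for z
  proof -
    obtain S S' where "finite S" "\<forall>y. y 0 = u z \<longrightarrow> (\<forall>i<m. y (Suc i) \<notin> S) \<longrightarrow> Q y \<noteq> 0"
      "finite S'" "\<forall>y. y 0 = u z \<longrightarrow> (\<forall>i<m. y (Suc i) \<notin> S') \<longrightarrow> Q' y \<noteq> 0"
      using P(3)[OF z] P'(3)[OF z] by blast
    then show ?thesis by (intro exI[of _ "S \<union> S'"]) auto
  qed
  show "rational_values u N m (\<lambda>z x. A z x \<and> B z x) (\<lambda>z x. g z x + h z x)"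
  proof (rule rational_valuesI[of "\<lambda>y. P y * Q' y + P' y * Q y", OF _ Q gen])
    show "(\<lambda>y. P y * Q' y + P' y * Q y) \<in> poly_funs (Suc m)"
      by (intro poly_funs_add poly_funs_mult P P')
    fix z x y
    assume "z \<in> N" "\<forall>i<m. \<not> has_pole_at u (x i)" "y = case_nat (u z) (\<lambda>i. u (x i))" "Q y * Q' y \<noteq> 0"
    with P(4)[of z x y] P'(4)[of z x y]
    show "(A z x \<and> B z x) \<and> g z x + h z x = (P y * Q' y + P' y * Q y) / (Q y * Q' y)"
      by (simp add: add_frac_eq)
  qed
  show "rational_values u N m (\<lambda>z x. A z x \<and> B z x) (\<lambda>z x. g z x * h z x)"
  proof (rule rational_valuesI[of "\<lambda>y. P y * P' y", OF _ Q gen])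
    show "(\<lambda>y. P y * P' y) \<in> poly_funs (Suc m)"
      by (intro poly_funs_mult P P')
    fix z x y
    assume "z \<in> N" "\<forall>i<m. \<not> has_pole_at u (x i)" "y = case_nat (u z) (\<lambda>i. u (x i))" "Q y * Q' y \<noteq> 0"
    with P(4)[of z x y] P'(4)[of z x y]
    show "(A z x \<and> B z x) \<and> g z x * h z x = (P y * P' y) / (Q y * Q' y)"
      by simp
  qed
qed

text \<open>Rational functions of \<open>u z\<close> without poles on \<open>N\<close>.\<close>

definition rational_scalars :: "(pline \<Rightarrow> complex) \<Rightarrow> pline set \<Rightarrow> (pline \<Rightarrow> complex) set" where
  "rational_scalars u N = {r. \<exists>P Q. \<forall>z\<in>N. poly Q (u z) \<noteq> 0 \<and> r z = poly P (u z) / poly Q (u z)}"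

lemma rational_scalars_const: "(\<lambda>_. c) \<in> rational_scalars u N"
  unfolding rational_scalars_def by (rule CollectI, intro exI[of _ "[:c:]"] exI[of _ 1]) simp

lemma rational_scalars_mult:
  assumes "r \<in> rational_scalars u N" "s \<in> rational_scalars u N"
  shows "(\<lambda>z. r z * s z) \<in> rational_scalars u N"
proof -
  obtain P Q P' Q' where "\<forall>z\<in>N. poly Q (u z) \<noteq> 0 \<and> r z = poly P (u z) / poly Q (u z)"
    "\<forall>z\<in>N. poly Q' (u z) \<noteq> 0 \<and> s z = poly P' (u z) / poly Q' (u z)"
    using assms unfolding rational_scalars_def by blast
  then have "\<forall>z\<in>N. poly (Q * Q') (u z) \<noteq> 0 \<and> r z * s z = poly (P * P') (u z) / poly (Q * Q') (u z)"
    by simp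
  then show ?thesis unfolding rational_scalars_def by blast
qed

lemma rational_values_scalar:
  assumes "r \<in> rational_scalars u N"
  shows "rational_values u N m (\<lambda>_ _. True) (\<lambda>z _. r z)"
proof -
  obtain P Q where PQ: "\<forall>z\<in>N. poly Q (u z) \<noteq> 0 \<and> r z = poly P (u z) / poly Q (u z)"
    using assms unfolding rational_scalars_def by blast
  show ?thesis
  proof (rule rational_valuesI)
    show "(\<lambda>y. poly P (y 0)) \<in> poly_funs (Suc m)" "(\<lambda>y. poly Q (y 0)) \<in> poly_funs (Suc m)"
      by (intro poly_funs_poly poly_funs_var; simp)+
    show "\<exists>S. finite S \<and> (\<forall>y. y 0 = u z \<longrightarrow> (\<forall>i<m. y (Suc i) \<notin> S) \<longrightarrow> poly Q (y 0) \<noteq> 0)" if "z \<in> N" for z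
      using PQ that by (intro exI[of _ "{}"]) simp
  qed (use PQ in auto)
qed

lemma rational_values_sum:
  assumes "finite I" "\<And>i. i \<in> I \<Longrightarrow> rational_values u N m (A i) (g i)"
  shows "rational_values u N m (\<lambda>z x. \<forall>i\<in>I. A i z x) (\<lambda>z x. \<Sum>i\<in>I. g i z x)"
  using assms
proof (induction I)
  case empty
  show ?case using rational_values_scalar[OF rational_scalars_const[of 0]] by simp
next
  case (insert i I)
  show ?case
    by (rule rational_values_weaken[OF rational_values_add[OF insert.prems insert.IH]])
      (use insert in auto)
qed

lemma rational_values_prod:
  assumes "finite I" "\<And>i. i \<in> I \<Longrightarrow> rational_values u N m (A i) (g i)"
  shows "rational_values u N m (\<lambda>z x. \<forall>i\<in>I. A i z x) (\<lambda>z x. \<Prod>i\<in>I. g i z x)"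
  using assms
proof (induction I)
  case empty
  show ?case using rational_values_scalar[OF rational_scalars_const[of 1]] by simp
next
  case (insert i I)
  show ?case
    by (rule rational_values_weaken[OF rational_values_mult[OF insert.prems insert.IH]])
      (use insert in auto)
qed

text \<open>Families of forms \<open>a z\<close> whose value at a point \<open>p\<close> is rational in \<open>u z\<close> and \<open>u p\<close>. The point is one of
  \<open>m\<close> points, so that all values occurring in a polydifferential share the same variables.\<close>

definition rational_forms :: "(pline \<Rightarrow> complex) \<Rightarrow> pline set \<Rightarrow> (pline \<Rightarrow> kform) set" where
  "rational_forms u N = {a. \<forall>m. \<forall>i<m.
     rational_values u N m (\<lambda>z x. regular_at (a z) (x i)) (\<lambda>z x. form_value u (a z) (x i))}"

lemma rational_forms_const:
  assumes u: "coordinate u" and N: "finite (- N)" "\<And>p. p \<in> N \<Longrightarrow> \<not> has_pole_at u p"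
    and reg: "\<And>p. p \<in> N \<Longrightarrow> regular_at \<alpha> p"
  shows "(\<lambda>_. \<alpha>) \<in> rational_forms u N"
  unfolding rational_forms_def
proof (intro CollectI allI impI)
  fix m i :: nat assume i: "i < m"
  obtain P Q where PQ: "\<And>p. \<not> has_pole_at u p \<Longrightarrow> poly Q (u p) \<noteq> 0 \<longleftrightarrow> p \<in> N"
    "\<And>p. p \<in> N \<Longrightarrow> form_value u \<alpha> p = poly P (u p) / poly Q (u p)"
    by (rule form_value_rational[OF assms]) (assumption | rule that)+
  show "rational_values u N m (\<lambda>z x. regular_at \<alpha> (x i)) (\<lambda>z x. form_value u \<alpha> (x i))"
  proof (rule rational_valuesI)
    show "(\<lambda>y. poly P (y (Suc i))) \<in> poly_funs (Suc m)" "(\<lambda>y. poly Q (y (Suc i))) \<in> poly_funs (Suc m)"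
      using i by (intro poly_funs_poly poly_funs_var; simp)+
    show "\<exists>S. finite S \<and> (\<forall>y. y 0 = u z \<longrightarrow> (\<forall>i<m. y (Suc i) \<notin> S) \<longrightarrow> poly Q (y (Suc i)) \<noteq> 0)" if z: "z \<in> N" for z
    proof -
      have "Q \<noteq> 0" using PQ(1)[OF N(2)[OF z]] z by auto
      then show ?thesis
        using i by (intro exI[of _ "{y. poly Q y = 0}"]) (auto simp: poly_roots_finite)
    qed
    show "regular_at \<alpha> (x i) \<and> form_value u \<alpha> (x i) = poly P (y (Suc i)) / poly Q (y (Suc i))"
      if "\<forall>i<m. \<not> has_pole_at u (x i)" "y = case_nat (u z) (\<lambda>i. u (x i))" "poly Q (y (Suc i)) \<noteq> 0" for z x y
      using PQ[of "x i"] reg[of "x i"] that i by simp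
  qed
qed

text \<open>The base point is \<open>w z\<close>, to cover both \<open>e(z)\<close> with \<open>z\<close> varying and \<open>e(z\<^sub>1)\<close> with \<open>z\<^sub>1\<close> fixed.\<close>

lemma rational_forms_e_form:
  assumes u: "coordinate u" and N: "\<And>p. p \<in> N \<Longrightarrow> \<not> has_pole_at u p"
    and w: "\<And>z. z \<in> N \<Longrightarrow> w z \<in> N" and H: "\<And>m. H \<in> poly_funs (Suc m)"
    and Hw: "\<And>z y. z \<in> N \<Longrightarrow> y 0 = u z \<Longrightarrow> H y = u (w z)"
  shows "(\<lambda>z. e_form u (w z)) \<in> rational_forms u N"
  unfolding rational_forms_def
proof (intro CollectI allI impI)
  fix m i :: nat assume i: "i < m"
  let ?Q = "\<lambda>y. (y (Suc i) + (- 1) * H y) * (y (Suc i) + (- 1) * H y)"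
  show "rational_values u N m (\<lambda>z x. regular_at (e_form u (w z)) (x i)) (\<lambda>z x. form_value u (e_form u (w z)) (x i))"
  proof (rule rational_valuesI)
    show "(\<lambda>_. - 1) \<in> poly_funs (Suc m)" "?Q \<in> poly_funs (Suc m)"
      by (intro poly_funs_add poly_funs_mult poly_funs_var poly_funs_const H; use i in simp)+
    show "\<exists>S. finite S \<and> (\<forall>y. y 0 = u z \<longrightarrow> (\<forall>i<m. y (Suc i) \<notin> S) \<longrightarrow> ?Q y \<noteq> 0)" if z: "z \<in> N" for z
      using i z Hw by (intro exI[of _ "{u (w z)}"]) auto
    show "regular_at (e_form u (w z)) (x i) \<and> form_value u (e_form u (w z)) (x i) = - 1 / ?Q y"
      if "z \<in> N" "\<forall>i<m. \<not> has_pole_at u (x i)" "y = case_nat (u z) (\<lambda>i. u (x i))" "?Q y \<noteq> 0" for z x y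
    proof -
      have "?Q y = (u (x i) - u (w z)) ^ 2" using that Hw by (simp add: power2_eq_square)
      then show ?thesis
        using e_form_regular_value[OF u N[OF w[OF that(1)]], of "x i"] that i by auto
    qed
  qed
qed

lemma polydiff_rational:
  assumes "G \<in> poly_family (rational_scalars u N) (rational_forms u N)"
  shows "rational_values u N m (\<lambda>z x. G z \<in> W_on (x ` {..<m})) (\<lambda>z x. polydiff u m x (G z))"
  using assms
proof induction
  case (poly_family_term r as)
  define n a where "n = length as" and "a = (\<lambda>j. as ! j)"
  let ?reg = "\<lambda>z x. \<forall>(j, i)\<in>{..<n} \<times> {..<m}. regular_at (a j z) (x i)"
  have val: "rational_values u N m (\<lambda>z x. regular_at (a j z) (x i)) (\<lambda>z x. form_value u (a j z) (x i))"
    if "j < n" "i < m" for j i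
  proof -
    have "a j \<in> rational_forms u N"
      using poly_family_term(2) that unfolding a_def n_def by auto
    then show ?thesis using that unfolding rational_forms_def by blast
  qed
  have "rational_values u N m (\<lambda>z x. \<forall>ji\<in>{..<n} \<times> {..<m}. regular_at (a (fst ji) z) (x (snd ji)))
      (\<lambda>z x. \<Prod>ji\<in>{..<n} \<times> {..<m}. form_value u (a (fst ji) z) (x (snd ji)))"
    by (rule rational_values_prod) (use val in auto)
  \<comment> \<open>The zero function, with a denominator that vanishes unless every form of the term is regular at every point.\<close>
  from rational_values_mult[OF rational_values_scalar[OF rational_scalars_const[of 0]] this]
  have zero: "rational_values u N m ?reg (\<lambda>_ _. 0)"
    by (rule rational_values_weaken) auto
  have "rational_values u N m (\<lambda>z x. \<forall>\<sigma>\<in>{\<sigma>. \<sigma> permutes {..<m}}. \<forall>i\<in>{..<m}. regular_at (a (\<sigma> i) z) (x i))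
      (\<lambda>z x. \<Sum>\<sigma> | \<sigma> permutes {..<m}. \<Prod>i<m. form_value u (a (\<sigma> i) z) (x i))" if "n = m"
  proof (intro rational_values_sum rational_values_prod)
    fix \<sigma> i assume "\<sigma> \<in> {\<sigma>. \<sigma> permutes {..<m}}" "i \<in> {..<m}"
    then show "rational_values u N m (\<lambda>z x. regular_at (a (\<sigma> i) z) (x i)) (\<lambda>z x. form_value u (a (\<sigma> i) z) (x i))"
      using permutes_in_image[of \<sigma> "{..<m}" i] that by (intro val) auto
  qed (auto intro: finite_permutations)
  from rational_values_mult[OF rational_values_scalar[OF poly_family_term(1)] this]
  have perm: "rational_values u N m (\<lambda>_ _. True)
      (\<lambda>z x. r z * (\<Sum>\<sigma> | \<sigma> permutes {..<m}. \<Prod>i<m. form_value u (a (\<sigma> i) z) (x i)))" if "n = m"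
    by (rule rational_values_weaken) (use that in auto)
  have prod: "(\<Prod>b\<leftarrow>as. embed (b z)) = (\<Prod>j<n. embed (a j z))" for z
    by (simp add: a_def n_def prod.list_conv_set_nth atLeast0LessThan)
  have mem: "(\<Prod>j<n. embed (a j z)) \<in> W_on (x ` {..<m})" if "?reg z x" for z x
    using that by (intro W_on_prod W_on_embed) auto
  have pd: "polydiff u m x (scalar (r z) * (\<Prod>j<n. embed (a j z))) =
     r z * (if n = m then \<Sum>\<sigma> | \<sigma> permutes {..<m}. \<Prod>i<m. form_value u (a (\<sigma> i) z) (x i) else 0)"
    if "?reg z x" for z x
  proof -
    have "polydiff u m x (scalar (r z) * (\<Prod>j<n. embed (a j z))) = r z * polydiff u m x (\<Prod>j<n. embed (a j z))"
      by (rule polydiff_scalar[OF refl mem[OF that]])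
    also have "polydiff u m x (\<Prod>j<n. embed (a j z)) =
       (if n = m then \<Sum>\<sigma> | \<sigma> permutes {..<m}. \<Prod>i<m. form_value u (a (\<sigma> i) z) (x i) else 0)"
      by (rule polydiff_prod[OF refl]) (use that in auto)
    finally show ?thesis .
  qed
  show ?case
    unfolding prod
  proof (cases "n = m")
    case True
    show "rational_values u N m (\<lambda>z x. scalar (r z) * (\<Prod>j<n. embed (a j z)) \<in> W_on (x ` {..<m}))
       (\<lambda>z x. polydiff u m x (scalar (r z) * (\<Prod>j<n. embed (a j z))))"
      by (rule rational_values_weaken[OF rational_values_add[OF zero perm[OF True]]])
        (use True pd mem in \<open>auto intro!: W_on_mult W_on_scalar\<close>)
  next
    case False
    show "rational_values u N m (\<lambda>z x. scalar (r z) * (\<Prod>j<n. embed (a j z)) \<in> W_on (x ` {..<m}))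
       (\<lambda>z x. polydiff u m x (scalar (r z) * (\<Prod>j<n. embed (a j z))))"
      by (rule rational_values_weaken[OF zero])
        (use False pd mem in \<open>auto intro!: W_on_mult W_on_scalar\<close>)
  qed
next
  case (poly_family_add G H)
  show ?case
    by (rule rational_values_weaken[OF rational_values_add[OF poly_family_add.IH]])
      (auto simp: polydiff_add[OF refl] intro: W_on_add)
qed


section \<open>Families built from the fields\<close>

text \<open>An element involves finitely many forms, and each form has finitely many poles.\<close>

lemma W_on_cofinite:
  assumes "v \<in> W_on {z}"
  shows "\<exists>N. finite (- N) \<and> z \<in> N \<and> v \<in> W_on N"
  using assms
proof induction
  case (W_on_scalar c)
  show ?case by (intro exI[of _ UNIV]) (auto intro: W_on.intros)
next
  case (W_on_embed \<alpha>)
  then show ?case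
    using finite_not_regular_at[of \<alpha>]
    by (intro exI[of _ "{p. regular_at \<alpha> p}"]) (auto simp: Collect_neg_eq[symmetric] intro: W_on.W_on_embed)
next
  case (W_on_add v w)
  then obtain M N where "finite (- M)" "z \<in> M" "v \<in> W_on M" "finite (- N)" "z \<in> N" "w \<in> W_on N" by blast
  then show ?case
    by (intro exI[of _ "M \<inter> N"]) (auto intro!: W_on.W_on_add elim: W_on_mono)
next
  case (W_on_mult v w)
  then obtain M N where "finite (- M)" "z \<in> M" "v \<in> W_on M" "finite (- N)" "z \<in> N" "w \<in> W_on N" by blast
  then show ?case
    by (intro exI[of _ "M \<inter> N"]) (auto intro!: W_on.W_on_mult elim: W_on_mono)
qed

lemma poly_family_rational_mult:
  "G \<in> poly_family (rational_scalars u N) A \<Longrightarrow> H \<in> poly_family (rational_scalars u N) A \<Longrightarrow>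
     (\<lambda>z. G z * H z) \<in> poly_family (rational_scalars u N) A"
  by (rule poly_family_mult[OF rational_scalars_mult])

lemma poly_family_const:
  assumes u: "coordinate u" and N: "finite (- N)" "\<And>p. p \<in> N \<Longrightarrow> \<not> has_pole_at u p"
    and w: "w \<in> W_on N"
  shows "(\<lambda>_. w) \<in> poly_family (rational_scalars u N) (rational_forms u N)"
  using w
proof induction
  case (W_on_scalar c)
  show ?case by (rule poly_family_scalar[OF rational_scalars_const])
next
  case (W_on_embed \<alpha>)
  then show ?case
    by (intro poly_family_embed[OF rational_scalars_const] rational_forms_const[OF u N])
qed (auto intro: poly_family_add poly_family_rational_mult)

lemma poly_family_i_field:
  assumes u: "coordinate u" and N: "finite (- N)" "\<And>p. p \<in> N \<Longrightarrow> \<not> has_pole_at u p"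
    and w: "w \<in> W_on N"
  shows "\<exists>G\<in>poly_family (rational_scalars u N) (rational_forms u N). \<forall>z\<in>N. i_field u z w = G z"
  using w
proof induction
  case (W_on_scalar c)
  show ?case
    using poly_family_scalar[OF rational_scalars_const[of 0 u N]]
    by (intro bexI[of _ "\<lambda>_. scalar 0"]) (simp_all add: i_field_scalar scalar_0)
next
  case (W_on_embed \<alpha>)
  obtain P Q where PQ: "\<And>p. \<not> has_pole_at u p \<Longrightarrow> poly Q (u p) \<noteq> 0 \<longleftrightarrow> p \<in> N"
    "\<And>p. p \<in> N \<Longrightarrow> form_value u \<alpha> p = poly P (u p) / poly Q (u p)"
    by (rule form_value_rational[OF assms(1-3) W_on_embed]) (assumption | rule that)+
  have "(\<lambda>z. poly (- P) (u z) / poly Q (u z)) \<in> rational_scalars u N"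
    unfolding rational_scalars_def using PQ(1) N(2) by blast
  then show ?case
    using PQ(2) W_on_embed
    by (intro bexI[of _ "\<lambda>z. scalar (poly (- P) (u z) / poly Q (u z))"] poly_family_scalar)
       (auto simp: i_field_embed)
next
  case (W_on_add v w)
  then obtain G H where "G \<in> poly_family (rational_scalars u N) (rational_forms u N)" "\<forall>z\<in>N. i_field u z v = G z"
    "H \<in> poly_family (rational_scalars u N) (rational_forms u N)" "\<forall>z\<in>N. i_field u z w = H z"
    by blast
  moreover have "v \<in> W_on {z}" "w \<in> W_on {z}" if "z \<in> N" for z
    using W_on_add that by (auto elim: W_on_mono)
  ultimately show ?case
    by (intro bexI[of _ "\<lambda>z. G z + H z"] poly_family_add) (auto simp: i_field_add)
next
  case (W_on_mult v w)
  then obtain G H where "G \<in> poly_family (rational_scalars u N) (rational_forms u N)" "\<forall>z\<in>N. i_field u z v = G z"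
    "H \<in> poly_family (rational_scalars u N) (rational_forms u N)" "\<forall>z\<in>N. i_field u z w = H z"
    by blast
  moreover have "v \<in> W_on {z}" "w \<in> W_on {z}" if "z \<in> N" for z
    using W_on_mult that by (auto elim: W_on_mono)
  ultimately show ?case
    using poly_family_const[OF assms(1-3)] W_on_mult(1,2)
    by (intro bexI[of _ "\<lambda>z. G z * w + v * H z"] poly_family_add poly_family_rational_mult)
       (auto simp: i_field_mult)
qed


section \<open>Contraction and normal ordering\<close>

lemma scalar_2: "scalar 2 = 2"
  using scalar_add[of 1 1] by (simp add: scalar_1)

text \<open>The normally ordered product of \<open>2 b(z)\<close> and \<open>T(z\<^sub>1)\<close>, applied to \<open>v\<close>: all factors \<open>e\<close> stand to the left
  of all factors \<open>i\<close>.\<close>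

definition bT_normal_ordered :: "(pline \<Rightarrow> complex) \<Rightarrow> pline \<Rightarrow> fock \<Rightarrow> pline \<Rightarrow> fock" where
  "bT_normal_ordered u z\<^sub>1 v z =
     i_field u z (i_field u z\<^sub>1 (i_field u z\<^sub>1 v))
     + e_field u z\<^sub>1 (e_field u z\<^sub>1 (i_field u z v))
     + 2 * e_field u z\<^sub>1 (i_field u z (i_field u z\<^sub>1 v))
     + e_field u z (i_field u z\<^sub>1 (i_field u z\<^sub>1 v) + e_field u z\<^sub>1 (e_field u z\<^sub>1 v)
         + 2 * e_field u z\<^sub>1 (i_field u z\<^sub>1 v))"

lemma bT_normal_ordered_diagonal: "bT_normal_ordered u z\<^sub>1 v z\<^sub>1 = S_field u z\<^sub>1 v"
  unfolding bT_normal_ordered_def S_field_def e_field_def by (simp add: algebra_simps)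

lemma bT_contraction:
  assumes u: "coordinate u" and z1: "\<not> has_pole_at u z\<^sub>1" and z: "\<not> has_pole_at u z" "z \<noteq> z\<^sub>1"
    and v: "v \<in> W_on {z\<^sub>1, z}"
  shows "T_field u z\<^sub>1 v \<in> W_on {z}"
    "2 * b_field u z (T_field u z\<^sub>1 v) - 2 * scalar (omega u z z\<^sub>1) * b_field u z\<^sub>1 v =
       bT_normal_ordered u z\<^sub>1 v z"
proof -
  let ?i = "i_field u z" and ?\<omega> = "scalar (omega u z z\<^sub>1)"
  define A B e e1 where "A = i_field u z\<^sub>1 (i_field u z\<^sub>1 v)" and "B = i_field u z\<^sub>1 v"
    and "e = embed (e_form u z)" and "e1 = embed (e_form u z\<^sub>1)"
  have "A \<in> W_on {z\<^sub>1, z}" "B \<in> W_on {z\<^sub>1, z}"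
    unfolding A_def B_def using v by (auto intro!: i_field_closed)
  then have mem: "A \<in> W_on {z}" "B \<in> W_on {z}" "v \<in> W_on {z}"
    using v by (auto elim: W_on_mono)
  have "u z \<noteq> u z\<^sub>1" using coordinate_inject[OF u z(1) z1] z(2) by blast
  note e_val = e_form_regular_value[OF u z1 z(1) this]
  have e1: "e1 \<in> W_on {z}" "?i e1 = ?\<omega>"
    unfolding e1_def using e_val by (simp_all add: W_on_regular i_field_embed omega_def)
  define X where "X = A + e1 * (e1 * v) + scalar 2 * (e1 * B)"
  have T: "T_field u z\<^sub>1 v = scalar (1 / 2) * X"
    by (simp add: T_field_def e_field_def X_def A_def B_def e1_def scalar_2 mult.assoc)
  have X: "X \<in> W_on {z}"
    unfolding X_def by (intro W_on_add W_on_mult W_on_scalar mem e1)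
  then show "T_field u z\<^sub>1 v \<in> W_on {z}"
    unfolding T by (intro W_on_mult W_on_scalar)
  have iX: "?i X = ?i A + (?\<omega> * (e1 * v) + e1 * (?\<omega> * v + e1 * ?i v)) + scalar 2 * (?\<omega> * B + e1 * ?i B)"
    unfolding X_def
    by (simp add: i_field_add i_field_mult i_field_scalar W_on_add W_on_mult W_on_scalar mem e1)
  have half: "2 * (scalar (1 / 2) * w) = w" for w
  proof -
    have "2 * scalar (1 / 2) = 1"
      unfolding scalar_2[symmetric] scalar_mult[symmetric] by (simp add: scalar_1)
    then show ?thesis by (simp add: mult.assoc[symmetric])
  qed
  have "2 * b_field u z (T_field u z\<^sub>1 v) = 2 * (scalar (1 / 2) * ?i X) + 2 * (scalar (1 / 2) * (e * X))"
    unfolding T b_field_def e_field_def e_def[symmetric]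
    by (simp only: i_field_mult[OF W_on_scalar X] i_field_scalar mult_zero_left add_0_left
        mult.left_commute[of e] distrib_left)
  also have "\<dots> = ?i X + e * X"
    by (simp only: half)
  finally have bT: "2 * b_field u z (T_field u z\<^sub>1 v) = ?i X + e * X" .
  show "2 * b_field u z (T_field u z\<^sub>1 v) - 2 * ?\<omega> * b_field u z\<^sub>1 v = bT_normal_ordered u z\<^sub>1 v z"
    unfolding bT iX by (simp add: X_def bT_normal_ordered_def e_field_def b_field_def A_def B_def e_def e1_def scalar_2 algebra_simps)
qed

lemma bT_normal_ordered_family:
  assumes u: "coordinate u" and N: "finite (- N)" "\<And>p. p \<in> N \<Longrightarrow> \<not> has_pole_at u p"
    and z1: "z\<^sub>1 \<in> N" and v: "v \<in> W_on N"
  shows "\<exists>G\<in>poly_family (rational_scalars u N) (rational_forms u N). \<forall>z\<in>N. bT_normal_ordered u z\<^sub>1 v z = G z"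
proof -
  let ?F = "poly_family (rational_scalars u N) (rational_forms u N)"
  define A B where "A = i_field u z\<^sub>1 (i_field u z\<^sub>1 v)" and "B = i_field u z\<^sub>1 v"
  have mem: "A \<in> W_on N" "B \<in> W_on N"
    unfolding A_def B_def using v z1 by (auto intro!: i_field_closed)
  obtain IA IB Iv where I: "IA \<in> ?F" "\<forall>z\<in>N. i_field u z A = IA z" "IB \<in> ?F" "\<forall>z\<in>N. i_field u z B = IB z"
    "Iv \<in> ?F" "\<forall>z\<in>N. i_field u z v = Iv z"
    using poly_family_i_field[OF u N] mem v by meson
  have "(\<lambda>z. e_form u z) \<in> rational_forms u N"
    by (rule rational_forms_e_form[OF u N(2), where w = "\<lambda>z. z" and H = "\<lambda>y. y 0"]) (auto intro: poly_funs_var)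
  then have e: "(\<lambda>z. embed (e_form u z)) \<in> ?F"
    by (rule poly_family_embed[OF rational_scalars_const])
  have "(\<lambda>z. e_form u z\<^sub>1) \<in> rational_forms u N"
    by (rule rational_forms_e_form[OF u N(2), where w = "\<lambda>_. z\<^sub>1" and H = "\<lambda>_. u z\<^sub>1"])
      (use z1 in \<open>auto intro: poly_funs_const\<close>)
  then have e1: "(\<lambda>z. embed (e_form u z\<^sub>1)) \<in> ?F"
    by (rule poly_family_embed[OF rational_scalars_const])
  let ?e = "\<lambda>z. embed (e_form u z)" and ?e1 = "embed (e_form u z\<^sub>1)"
  let ?G = "\<lambda>z. IA z + ?e1 * (?e1 * Iv z) + scalar 2 * (?e1 * IB z)
    + ?e z * (A + ?e1 * (?e1 * v) + scalar 2 * (?e1 * B))"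
  have "?G \<in> ?F"
    by (intro poly_family_add poly_family_rational_mult poly_family_scalar[OF rational_scalars_const]
        I e e1 poly_family_const[OF u N] mem v)
  moreover have "\<forall>z\<in>N. bT_normal_ordered u z\<^sub>1 v z = ?G z"
    using I(2,4,6) by (simp add: bT_normal_ordered_def e_field_def A_def B_def scalar_2)
  ultimately show ?thesis by (intro bexI[of _ ?G])
qed

theorem proposition4p2:
  fixes u :: "pline \<Rightarrow> complex" and z\<^sub>1 :: pline and v :: fock
  assumes "coordinate u" and "\<not> has_pole_at u z\<^sub>1" and "v \<in> W_on {z\<^sub>1}"
  shows "limit_at u z\<^sub>1 {z\<^sub>2. T_field u z\<^sub>1 v \<in> W_on {z\<^sub>2}}
           (\<lambda>z\<^sub>2. 2 * b_field u z\<^sub>2 (T_field u z\<^sub>1 v)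
                 - 2 * scalar (omega u z\<^sub>2 z\<^sub>1) * b_field u z\<^sub>1 v)
           (S_field u z\<^sub>1 v)"
proof -
  let ?E = "\<lambda>z\<^sub>2. 2 * b_field u z\<^sub>2 (T_field u z\<^sub>1 v) - 2 * scalar (omega u z\<^sub>2 z\<^sub>1) * b_field u z\<^sub>1 v"
  let ?w = "\<lambda>z. (?E(z\<^sub>1 := S_field u z\<^sub>1 v)) z"
  obtain N0 where N0: "finite (- N0)" "z\<^sub>1 \<in> N0" "v \<in> W_on N0"
    using W_on_cofinite[OF assms(3)] by blast
  define N where "N = N0 - {p. has_pole_at u p}"
  obtain p0 where "\<And>p. has_pole_at u p \<longleftrightarrow> p = p0"
    using assms(1) unfolding coordinate_def by blast
  then have "- N \<subseteq> insert p0 (- N0)" by (auto simp: N_def)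
  then have fin: "finite (- N)" using N0(1) finite_subset by blast
  have pole: "\<not> has_pole_at u z" if "z \<in> N" for z using that by (simp add: N_def)
  have z1: "z\<^sub>1 \<in> N" using N0 assms(2) by (simp add: N_def)
  have v: "v \<in> W_on N" using N0(3) by (rule W_on_mono) (auto simp: N_def)
  have v2: "v \<in> W_on {z\<^sub>1, z}" if "z \<in> N" for z
    using v by (rule W_on_mono) (use z1 that in auto)
  have sub: "N - {z\<^sub>1} \<subseteq> {z\<^sub>2. T_field u z\<^sub>1 v \<in> W_on {z\<^sub>2}}"
    using bT_contraction(1)[OF assms(1,2) pole _ v2] by blast
  have w: "?w z = bT_normal_ordered u z\<^sub>1 v z" if "z \<in> N" for z
    using bT_contraction(2)[OF assms(1,2) pole[OF that] _ v2[OF that]]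
    by (simp add: bT_normal_ordered_diagonal)
  obtain G where G: "G \<in> poly_family (rational_scalars u N) (rational_forms u N)"
    "\<forall>z\<in>N. bT_normal_ordered u z\<^sub>1 v z = G z"
    using bT_normal_ordered_family[OF assms(1) fin pole z1 v] by blast
  have rat: "\<exists>P\<in>poly_funs (Suc m). \<exists>Q\<in>poly_funs (Suc m). \<forall>z\<in>N.
          (\<exists>y. Q (y(0 := u z)) \<noteq> 0) \<and>
          (\<forall>x. (\<forall>i<m. \<not> has_pole_at u (x i)) \<longrightarrow>
             (let y = case_nat (u z) (\<lambda>i. u (x i)); w = ?w z
              in Q y \<noteq> 0 \<longrightarrow> w \<in> W_on (x ` {..<m}) \<and> polydiff u m x w = P y / Q y))" for m
  proof (rule rational_valuesE[OF polydiff_rational[OF G(1), of m]])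
    fix P Q
    assume PQ: "P \<in> poly_funs (Suc m)" "Q \<in> poly_funs (Suc m)"
      "\<And>z. z \<in> N \<Longrightarrow> \<exists>S. finite S \<and> (\<forall>y. y 0 = u z \<longrightarrow> (\<forall>i<m. y (Suc i) \<notin> S) \<longrightarrow> Q y \<noteq> 0)"
      "\<And>z x y. z \<in> N \<Longrightarrow> \<forall>i<m. \<not> has_pole_at u (x i) \<Longrightarrow> y = case_nat (u z) (\<lambda>i. u (x i)) \<Longrightarrow> Q y \<noteq> 0 \<Longrightarrow>
        G z \<in> W_on (x ` {..<m}) \<and> polydiff u m x (G z) = P y / Q y"
    show ?thesis
    proof (rule bexI[OF _ PQ(1)], rule bexI[OF _ PQ(2)], intro ballI conjI allI impI)
      fix z assume z: "z \<in> N"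
      obtain S where S: "finite S" "\<forall>y. y 0 = u z \<longrightarrow> (\<forall>i<m. y (Suc i) \<notin> S) \<longrightarrow> Q y \<noteq> 0"
        using PQ(3)[OF z] by blast
      obtain c where "c \<notin> S"
        using ex_new_if_finite[OF infinite_UNIV_char_0 S(1)] by blast
      then show "\<exists>y. Q (y(0 := u z)) \<noteq> 0"
        using S(2) by (intro exI[of _ "\<lambda>_. c"]) simp
      fix x assume "\<forall>i<m. \<not> has_pole_at u (x i)"
      then show "let y = case_nat (u z) (\<lambda>i. u (x i)); w = ?w z
              in Q y \<noteq> 0 \<longrightarrow> w \<in> W_on (x ` {..<m}) \<and> polydiff u m x w = P y / Q y"
        unfolding Let_def w[OF z] G(2)[rule_format, OF z] using PQ(4)[OF z _ refl] by blast
    qed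
  qed
  show ?thesis
    unfolding limit_at_def
    by (rule exI[of _ N], intro conjI fin z1 sub ballI pole allI rat)
qed

end
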